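(* Specifying a model of the theory $\mathbb{T}_\Pi$ of natural models admitting dependent product types is equivalent to specifying a natural model $(\mathbb{C},p:\dot{\mathcal U}\to\mathcal U)$ together with natural transformations $$\widehat{\Pi}:\sum_{A:\mathcal{U}}\mathcal{U}^{[A]}\to\mathcal{U},\qquad \widehat{\lambda}:\sum_{A:\mathcal{U}}\dot{\mathcal{U}}^{[A]}\to\dot{\mathcal{U}}$$ such that the square with top $\widehat{\lambda}$, right $p$, bottom $\widehat{\Pi}$ and left $\sum_{A:\mathcal{U}}p^{[A]}$ is a pullback in $\widehat{\mathbb{C}}$. (The correspondence is $\widehat{\Pi}_\Gamma(A,B)=\mathsf{pi}(A,B)$ and $\widehat{\lambda}_\Gamma(A,b)=\mathsf{lambda}_{A,B}(b)$ where $B$ is the type of $b$.)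
   Context: Write $\mathsf{y}$ for the Yoneda embedding of a small category $\mathbb{C}$ into $\widehat{\mathbb{C}}=\mathbf{Set}^{\mathbb{C}^{\mathrm{op}}}$; elements $x\in P(\Gamma)$ are identified with maps $x:\mathsf{y}(\Gamma)\to P$, and $x[\sigma]=P(\sigma)(x)$. A natural model $(\mathbb{C},p)$ consists of a small category $\mathbb{C}$ with a distinguished terminal object $\diamond$, presheaves $\mathcal{U},\dot{\mathcal{U}}$ on $\mathbb{C}$, a natural transformation $p:\dot{\mathcal{U}}\to\mathcal{U}$ and, for each object $\Gamma$ and $A\in\mathcal{U}(\Gamma)$, a chosen object $\Gamma\cdot A$, morphism $\mathsf{p}_A:\Gamma\cdot A\to\Gamma$ and element $\mathsf{q}_A\in\dot{\mathcal{U}}(\Gamma\cdot A)$ such that the square with top $\mathsf{q}_A$, right $p$, left $\mathsf{y}(\mathsf{p}_A)$, bottom $A$ is a pullback. Write $\dot{\mathcal{U}}(\Gamma;A)=p_\Gamma^{-1}(A)$. For $\sigma:\Delta\to\Gamma$ and $a\in\dot{\mathcal{U}}(\Delta;A[\sigma])$, $\langle\sigma,a\rangle_A:\Delta\to\Gamma\cdot A$ is the unique map with $\mathsf{p}_A\circ\langle\sigma,a\rangle_A=\sigma$, $\mathsf{q}_A[\langle\sigma,a\rangle_A]=a$; $\mathsf{s}(a)=\langle\mathrm{id}_\Gamma,a\rangle_A$ for $a\in\dot{\mathcal U}(\Gamma;A)$; and $\sigma\cdot A=\langle\sigma\circ\mathsf{p}_{A[\sigma]},\mathsf{q}_{A[\sigma]}\rangle_A:\Delta\cdot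 A[\sigma]\to\Gamma\cdot A$. In the internal language of $\widehat{\mathbb{C}}$, $[A]$ denotes the fibre of $p$ over $A:\mathcal{U}$. Concretely (up to natural isomorphism), for a presheaf $X$, $\big(\sum_{A:\mathcal{U}}X^{[A]}\big)(\Gamma)=\{(A,x):A\in\mathcal{U}(\Gamma),\,x\in X(\Gamma\cdot A)\}$ with $(A,x)[\sigma]=(A[\sigma],x[\sigma\cdot A])$, and $\sum_{A:\mathcal U}p^{[A]}$ sends $(A,b)$ to $(A,p_{\Gamma\cdot A}(b))$. Natural models are exactly the models of an essentially algebraic theory $\mathbb{T}$ (sorts: contexts = objects of $\mathbb{C}$, substitutions = morphisms, types = elements of the $\mathcal{U}(\Gamma)$, terms = elements of the $\dot{\mathcal{U}}(\Gamma)$). The theory $\mathbb{T}_\Pi$ extends $\mathbb{T}$ by partial operations, defined precisely for $\Gamma$, $A\in\mathcal{U}(\Gamma)$, $B\in\mathcal{U}(\Gamma\cdot A)$ and: $\mathsf{pi}(A,B)$ (a type); $\mathsf{lambda}_{A,B}(b)$ (a term) for $b\in\dot{\mathcal{U}}(\Gamma\cdot A;B)$; $\mathsf{app}_{A,B}(f,a)$ (a term) for $f$ a term of type $\mathsf{pi}(A,B)$ and $a\in\dot{\mathcal{U}}(\Gamma;A)$; subject to the equations - $\mathsf{pi}(A,B)\in\mathcal{U}(\Gamma)$, $\mathsf{pi}(A,B)[\sigma]=\mathsf{pi}(A[\sigma],B[\sigma\cdot A])$; - $\mathsf{lambda}_{A,B}(b)$ has type $\mathsf{pi}(A,B)$,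 $\mathsf{lambda}_{A,B}(b)[\sigma]=\mathsf{lambda}_{A[\sigma],B[\sigma\cdot A]}(b[\sigma\cdot A])$; - $\mathsf{app}_{A,B}(f,a)$ has type $B[\mathsf{s}(a)]$, $\mathsf{app}_{A,B}(f,a)[\sigma]=\mathsf{app}_{A[\sigma],B[\sigma\cdot A]}(f[\sigma],a[\sigma])$; - $\mathsf{app}_{A,B}(\mathsf{lambda}_{A,B}(b),a)=b[\mathsf{s}(a)]$; - $\mathsf{lambda}_{A,B}\big(\mathsf{app}_{A[\mathsf{p}_A],\,B[\mathsf{p}_A\cdot A]}(f[\mathsf{p}_A],\mathsf{q}_A)\big)=f$. *)

theory Defs
  imports "HOL-Library.FuncSet"
begin

section \<open>Categories\<close>

record ('o, 'm) cat =
  Obj :: "'o set"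
  Arr :: "'m set"
  Dom :: "'m \<Rightarrow> 'o"
  Cod :: "'m \<Rightarrow> 'o"
  idt :: "'o \<Rightarrow> 'm"
  cmp :: "'m \<Rightarrow> 'm \<Rightarrow> 'm"

definition hom :: "('o, 'm) cat \<Rightarrow> 'o \<Rightarrow> 'o \<Rightarrow> 'm set" where
  "hom C X Y = {f \<in> Arr C. Dom C f = X \<and> Cod C f = Y}"

text \<open>\<open>cmp C g f\<close> is the composite of \<open>f\<close> followed by \<open>g\<close>.\<close>

locale category =
  fixes C :: "('o, 'm) cat"
  assumes dom_obj: "f \<in> Arr C \<Longrightarrow> Dom C f \<in> Obj C"
    and cod_obj: "f \<in> Arr C \<Longrightarrow> Cod C f \<in> Obj C"
    and idt_hom: "X \<in> Obj C \<Longrightarrow> idt C X \<in> hom C X X"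
    and cmp_hom: "f \<in> hom C X Y \<Longrightarrow> g \<in> hom C Y Z \<Longrightarrow> cmp C g f \<in> hom C X Z"
    and cmp_idt_left: "f \<in> hom C X Y \<Longrightarrow> cmp C (idt C Y) f = f"
    and cmp_idt_right: "f \<in> hom C X Y \<Longrightarrow> cmp C f (idt C X) = f"
    and cmp_assoc: "f \<in> hom C W X \<Longrightarrow> g \<in> hom C X Y \<Longrightarrow> h \<in> hom C Y Z
      \<Longrightarrow> cmp C (cmp C h g) f = cmp C h (cmp C g f)"

definition terminal :: "('o, 'm) cat \<Rightarrow> 'o \<Rightarrow> bool" where
  "terminal C T \<longleftrightarrow> T \<in> Obj C \<and> (\<forall>X \<in> Obj C. \<exists>!f. f \<in> hom C X T)"

text \<open>
  Types play the role of universes of sets: the sets of the universe \<open>TYPE('x)\<close> are the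
  subsets of \<open>'x\<close>, so a category is small relative to it if its arrows (and hence, through
  the identities, its objects) can be indexed by elements of \<open>'x\<close>.
\<close>

definition small :: "'x itself \<Rightarrow> ('o, 'm) cat \<Rightarrow> bool" where
  "small \<U> C \<longleftrightarrow> (\<exists>i :: 'm \<Rightarrow> 'x. inj_on i (Arr C))"


section \<open>Presheaves\<close>

text \<open>
  \<open>act F \<sigma> x\<close> is the element \<open>x[\<sigma>]\<close>, that is \<open>F(\<sigma>)(x)\<close>. It is only constrained for
  arrows \<open>\<sigma>\<close> and elements \<open>x\<close> of \<open>F\<close> at the codomain of \<open>\<sigma>\<close>.
\<close>

record ('o, 'm, 'x) psh =
  el :: "'o \<Rightarrow> 'x set"
  act :: "'m \<Rightarrow> 'x \<Rightarrow> 'x"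

locale presheaf = category C
  for C :: "('o, 'm) cat" +
  fixes F :: "('o, 'm, 'x) psh"
  assumes act_el: "\<sigma> \<in> hom C \<Delta> \<Gamma> \<Longrightarrow> x \<in> el F \<Gamma> \<Longrightarrow> act F \<sigma> x \<in> el F \<Delta>"
    and act_idt: "\<Gamma> \<in> Obj C \<Longrightarrow> x \<in> el F \<Gamma> \<Longrightarrow> act F (idt C \<Gamma>) x = x"
    and act_cmp: "\<tau> \<in> hom C \<Theta> \<Delta> \<Longrightarrow> \<sigma> \<in> hom C \<Delta> \<Gamma> \<Longrightarrow> x \<in> el F \<Gamma>
      \<Longrightarrow> act F (cmp C \<sigma> \<tau>) x = act F \<tau> (act F \<sigma> x)"

text \<open>
  The components of a natural transformation are extensional functions (\<open>undefined\<close> outside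
  their domain), so that equality of natural transformations is equality in HOL.
\<close>

definition nat_trans ::
  "('o, 'm) cat \<Rightarrow> ('o, 'm, 'x) psh \<Rightarrow> ('o, 'm, 'y) psh \<Rightarrow> ('o \<Rightarrow> 'x \<Rightarrow> 'y) \<Rightarrow> bool" where
  "nat_trans C F G \<eta> \<longleftrightarrow>
     presheaf C F \<and> presheaf C G \<and>
     \<eta> \<in> (\<Pi>\<^sub>E \<Gamma> \<in> Obj C. el F \<Gamma> \<rightarrow>\<^sub>E el G \<Gamma>) \<and>
     (\<forall>\<Delta> \<in> Obj C. \<forall>\<Gamma> \<in> Obj C. \<forall>\<sigma> \<in> hom C \<Delta> \<Gamma>. \<forall>x \<in> el F \<Gamma>.
        \<eta> \<Delta> (act F \<sigma> x) = act G \<sigma> (\<eta> \<Gamma> x))"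

text \<open>\<open>vcomp C F \<theta> \<eta>\<close> is the composite of \<open>\<eta>\<close>, with domain \<open>F\<close>, followed by \<open>\<theta>\<close>.\<close>

definition vcomp ::
  "('o, 'm) cat \<Rightarrow> ('o, 'm, 'x) psh \<Rightarrow> ('o \<Rightarrow> 'y \<Rightarrow> 'z) \<Rightarrow> ('o \<Rightarrow> 'x \<Rightarrow> 'y) \<Rightarrow> 'o \<Rightarrow> 'x \<Rightarrow> 'z" where
  "vcomp C F \<theta> \<eta> = (\<lambda>\<Gamma> \<in> Obj C. compose (el F \<Gamma>) (\<theta> \<Gamma>) (\<eta> \<Gamma>))"

text \<open>
  \<open>is_pullback \<U> C P X Y Z tt ll rr bb\<close> states that the square
  \<open>tt : P \<rightarrow> X\<close>, \<open>rr : X \<rightarrow> Z\<close>, \<open>ll : P \<rightarrow> Y\<close>, \<open>bb : Y \<rightarrow> Z\<close> of presheaves on \<open>C\<close>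
  is a pullback. The universal property ranges over all cones whose vertex is a presheaf of
  sets in the universe \<open>\<U>\<close>; if \<open>C\<close> is small, these include all representables up to
  isomorphism.
\<close>

definition is_pullback ::
  "'x itself \<Rightarrow> ('o, 'm) cat \<Rightarrow>
   ('o, 'm, 'p) psh \<Rightarrow> ('o, 'm, 'a) psh \<Rightarrow> ('o, 'm, 'b) psh \<Rightarrow> ('o, 'm, 'c) psh \<Rightarrow>
   ('o \<Rightarrow> 'p \<Rightarrow> 'a) \<Rightarrow> ('o \<Rightarrow> 'p \<Rightarrow> 'b) \<Rightarrow> ('o \<Rightarrow> 'a \<Rightarrow> 'c) \<Rightarrow> ('o \<Rightarrow> 'b \<Rightarrow> 'c) \<Rightarrow> bool" where
  "is_pullback \<U> C P X Y Z tt ll rr bb \<longleftrightarrow>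
     nat_trans C P X tt \<and> nat_trans C P Y ll \<and>
     nat_trans C X Z rr \<and> nat_trans C Y Z bb \<and>
     vcomp C P rr tt = vcomp C P bb ll \<and>
     (\<forall>(Q :: ('o, 'm, 'x) psh) f g.
        nat_trans C Q X f \<and> nat_trans C Q Y g \<and> vcomp C Q rr f = vcomp C Q bb g \<longrightarrow>
        (\<exists>!h. nat_trans C Q P h \<and> vcomp C Q tt h = f \<and> vcomp C Q ll h = g))"

definition yo :: "('o, 'm) cat \<Rightarrow> 'o \<Rightarrow> ('o, 'm, 'm) psh" where
  "yo C \<Gamma> = \<lparr>el = (\<lambda>\<Delta>. hom C \<Delta> \<Gamma>), act = (\<lambda>\<sigma> \<tau>. cmp C \<tau> \<sigma>)\<rparr>"

definition yo_map :: "('o, 'm) cat \<Rightarrow> 'm \<Rightarrow> 'o \<Rightarrow> 'm \<Rightarrow> 'm" where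
  "yo_map C f = (\<lambda>\<Delta> \<in> Obj C. \<lambda>\<sigma> \<in> hom C \<Delta> (Dom C f). cmp C f \<sigma>)"

text \<open>The map out of the representable on \<open>\<Gamma>\<close> that corresponds to \<open>x \<in> el F \<Gamma>\<close>.\<close>

definition yo_el :: "('o, 'm) cat \<Rightarrow> ('o, 'm, 'x) psh \<Rightarrow> 'o \<Rightarrow> 'x \<Rightarrow> 'o \<Rightarrow> 'm \<Rightarrow> 'x" where
  "yo_el C F \<Gamma> x = (\<lambda>\<Delta> \<in> Obj C. \<lambda>\<sigma> \<in> hom C \<Delta> \<Gamma>. act F \<sigma> x)"


section \<open>Natural models\<close>

text \<open>
  The sets \<open>el F \<Gamma>\<close> for different \<open>\<Gamma>\<close> need not be disjoint, so the operations on types and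
  terms take the context as an explicit argument.
\<close>

record ('o, 'm, 'ty, 'tm) nat_model =
  Cx :: "('o, 'm) cat"
  Emp :: 'o
  Ty :: "('o, 'm, 'ty) psh"
  Tm :: "('o, 'm, 'tm) psh"
  tp :: "'o \<Rightarrow> 'tm \<Rightarrow> 'ty"
  ext :: "'o \<Rightarrow> 'ty \<Rightarrow> 'o"
  wk :: "'o \<Rightarrow> 'ty \<Rightarrow> 'm"
  var :: "'o \<Rightarrow> 'ty \<Rightarrow> 'tm"

locale natural_model = category "Cx N"
  for \<U> :: "'x itself" and N :: "('o, 'm, 'ty, 'tm) nat_model" +
  assumes small: "small \<U> (Cx N)"
    and terminal_Emp: "terminal (Cx N) (Emp N)"
    and tp_nat: "nat_trans (Cx N) (Tm N) (Ty N) (tp N)"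
    and ext_obj: "\<Gamma> \<in> Obj (Cx N) \<Longrightarrow> A \<in> el (Ty N) \<Gamma> \<Longrightarrow> ext N \<Gamma> A \<in> Obj (Cx N)"
    and wk_hom: "\<Gamma> \<in> Obj (Cx N) \<Longrightarrow> A \<in> el (Ty N) \<Gamma> \<Longrightarrow> wk N \<Gamma> A \<in> hom (Cx N) (ext N \<Gamma> A) \<Gamma>"
    and var_el: "\<Gamma> \<in> Obj (Cx N) \<Longrightarrow> A \<in> el (Ty N) \<Gamma> \<Longrightarrow> var N \<Gamma> A \<in> el (Tm N) (ext N \<Gamma> A)"
    and ext_pullback: "\<Gamma> \<in> Obj (Cx N) \<Longrightarrow> A \<in> el (Ty N) \<Gamma> \<Longrightarrow>
      is_pullback \<U> (Cx N) (yo (Cx N) (ext N \<Gamma> A)) (Tm N) (yo (Cx N) \<Gamma>) (Ty N)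
        (yo_el (Cx N) (Tm N) (ext N \<Gamma> A) (var N \<Gamma> A)) (yo_map (Cx N) (wk N \<Gamma> A))
        (tp N) (yo_el (Cx N) (Ty N) \<Gamma> A)"

definition tms :: "('o, 'm, 'ty, 'tm) nat_model \<Rightarrow> 'o \<Rightarrow> 'ty \<Rightarrow> 'tm set" where
  "tms N \<Gamma> A = {a \<in> el (Tm N) \<Gamma>. tp N \<Gamma> a = A}"

text \<open>
  \<open>pair N \<sigma> A a\<close> is the extended substitution \<open>\<langle>\<sigma>, a\<rangle>\<^sub>A\<close>, \<open>sect N \<Gamma> A a\<close> is the section
  \<open>s(a) = \<langle>id, a\<rangle>\<^sub>A\<close>, and \<open>lift N \<sigma> A\<close> is \<open>\<sigma> \<cdot> A\<close>.
\<close>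

definition pair :: "('o, 'm, 'ty, 'tm) nat_model \<Rightarrow> 'm \<Rightarrow> 'ty \<Rightarrow> 'tm \<Rightarrow> 'm" where
  "pair N \<sigma> A a =
     (let \<Delta> = Dom (Cx N) \<sigma>; \<Gamma> = Cod (Cx N) \<sigma> in
      THE \<tau>. \<tau> \<in> hom (Cx N) \<Delta> (ext N \<Gamma> A) \<and>
        cmp (Cx N) (wk N \<Gamma> A) \<tau> = \<sigma> \<and> act (Tm N) \<tau> (var N \<Gamma> A) = a)"

definition sect :: "('o, 'm, 'ty, 'tm) nat_model \<Rightarrow> 'o \<Rightarrow> 'ty \<Rightarrow> 'tm \<Rightarrow> 'm" where
  "sect N \<Gamma> A a = pair N (idt (Cx N) \<Gamma>) A a"

definition lift :: "('o, 'm, 'ty, 'tm) nat_model \<Rightarrow> 'm \<Rightarrow> 'ty \<Rightarrow> 'm" where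
  "lift N \<sigma> A =
     (let \<Delta> = Dom (Cx N) \<sigma>; A' = act (Ty N) \<sigma> A in
      pair N (cmp (Cx N) \<sigma> (wk N \<Delta> A')) A (var N \<Delta> A'))"


section \<open>Dependent products\<close>

text \<open>
  The partial operations are extensional functions on exactly their domains of definition;
  membership in the dependent function spaces also contains the typing equations.
\<close>

locale pi_model = natural_model \<U> N
  for \<U> :: "'x itself" and N :: "('o, 'm, 'ty, 'tm) nat_model" +
  fixes pi :: "'o \<Rightarrow> 'ty \<Rightarrow> 'ty \<Rightarrow> 'ty"
    and lam :: "'o \<Rightarrow> 'ty \<Rightarrow> 'ty \<Rightarrow> 'tm \<Rightarrow> 'tm"
    and app :: "'o \<Rightarrow> 'ty \<Rightarrow> 'ty \<Rightarrow> 'tm \<Rightarrow> 'tm \<Rightarrow> 'tm"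
  assumes pi_type:
      "pi \<in> (\<Pi>\<^sub>E \<Gamma> \<in> Obj (Cx N). \<Pi>\<^sub>E A \<in> el (Ty N) \<Gamma>. el (Ty N) (ext N \<Gamma> A) \<rightarrow>\<^sub>E el (Ty N) \<Gamma>)"
    and lam_type:
      "lam \<in> (\<Pi>\<^sub>E \<Gamma> \<in> Obj (Cx N). \<Pi>\<^sub>E A \<in> el (Ty N) \<Gamma>. \<Pi>\<^sub>E B \<in> el (Ty N) (ext N \<Gamma> A).
         tms N (ext N \<Gamma> A) B \<rightarrow>\<^sub>E tms N \<Gamma> (pi \<Gamma> A B))"
    and app_type:
      "app \<in> (\<Pi>\<^sub>E \<Gamma> \<in> Obj (Cx N). \<Pi>\<^sub>E A \<in> el (Ty N) \<Gamma>. \<Pi>\<^sub>E B \<in> el (Ty N) (ext N \<Gamma> A).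
         \<Pi>\<^sub>E f \<in> tms N \<Gamma> (pi \<Gamma> A B). \<Pi>\<^sub>E a \<in> tms N \<Gamma> A. tms N \<Gamma> (act (Ty N) (sect N \<Gamma> A a) B))"
    and pi_subst:
      "\<lbrakk>\<Delta> \<in> Obj (Cx N); \<Gamma> \<in> Obj (Cx N); \<sigma> \<in> hom (Cx N) \<Delta> \<Gamma>;
        A \<in> el (Ty N) \<Gamma>; B \<in> el (Ty N) (ext N \<Gamma> A)\<rbrakk> \<Longrightarrow>
       act (Ty N) \<sigma> (pi \<Gamma> A B) = pi \<Delta> (act (Ty N) \<sigma> A) (act (Ty N) (lift N \<sigma> A) B)"
    and lam_subst:
      "\<lbrakk>\<Delta> \<in> Obj (Cx N); \<Gamma> \<in> Obj (Cx N); \<sigma> \<in> hom (Cx N) \<Delta> \<Gamma>;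
        A \<in> el (Ty N) \<Gamma>; B \<in> el (Ty N) (ext N \<Gamma> A); b \<in> tms N (ext N \<Gamma> A) B\<rbrakk> \<Longrightarrow>
       act (Tm N) \<sigma> (lam \<Gamma> A B b) =
         lam \<Delta> (act (Ty N) \<sigma> A) (act (Ty N) (lift N \<sigma> A) B) (act (Tm N) (lift N \<sigma> A) b)"
    and app_subst:
      "\<lbrakk>\<Delta> \<in> Obj (Cx N); \<Gamma> \<in> Obj (Cx N); \<sigma> \<in> hom (Cx N) \<Delta> \<Gamma>;
        A \<in> el (Ty N) \<Gamma>; B \<in> el (Ty N) (ext N \<Gamma> A);
        f \<in> tms N \<Gamma> (pi \<Gamma> A B); a \<in> tms N \<Gamma> A\<rbrakk> \<Longrightarrow>
       act (Tm N) \<sigma> (app \<Gamma> A B f a) =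
         app \<Delta> (act (Ty N) \<sigma> A) (act (Ty N) (lift N \<sigma> A) B) (act (Tm N) \<sigma> f) (act (Tm N) \<sigma> a)"
    and beta:
      "\<lbrakk>\<Gamma> \<in> Obj (Cx N); A \<in> el (Ty N) \<Gamma>; B \<in> el (Ty N) (ext N \<Gamma> A);
        b \<in> tms N (ext N \<Gamma> A) B; a \<in> tms N \<Gamma> A\<rbrakk> \<Longrightarrow>
       app \<Gamma> A B (lam \<Gamma> A B b) a = act (Tm N) (sect N \<Gamma> A a) b"
    and eta:
      "\<lbrakk>\<Gamma> \<in> Obj (Cx N); A \<in> el (Ty N) \<Gamma>; B \<in> el (Ty N) (ext N \<Gamma> A);
        f \<in> tms N \<Gamma> (pi \<Gamma> A B)\<rbrakk> \<Longrightarrow>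
       lam \<Gamma> A B
         (app (ext N \<Gamma> A) (act (Ty N) (wk N \<Gamma> A) A) (act (Ty N) (lift N (wk N \<Gamma> A) A) B)
           (act (Tm N) (wk N \<Gamma> A) f) (var N \<Gamma> A)) = f"

text \<open>The presheaf \<open>\<Sum>\<^sub>A X\<^sup>[\<^sup>A\<^sup>]\<close> in its concrete form, and its action on natural
  transformations out of \<open>X\<close>.\<close>

definition sum_psh ::
  "('o, 'm, 'ty, 'tm) nat_model \<Rightarrow> ('o, 'm, 'x) psh \<Rightarrow> ('o, 'm, 'ty \<times> 'x) psh" where
  "sum_psh N X =
     \<lparr>el = (\<lambda>\<Gamma>. SIGMA A : el (Ty N) \<Gamma>. el X (ext N \<Gamma> A)),
      act = (\<lambda>\<sigma> (A, x). (act (Ty N) \<sigma> A, act X (lift N \<sigma> A) x))\<rparr>"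

definition sum_map ::
  "('o, 'm, 'ty, 'tm) nat_model \<Rightarrow> ('o, 'm, 'x) psh \<Rightarrow> ('o \<Rightarrow> 'x \<Rightarrow> 'y) \<Rightarrow>
   'o \<Rightarrow> 'ty \<times> 'x \<Rightarrow> 'ty \<times> 'y" where
  "sum_map N X \<theta> =
     (\<lambda>\<Gamma> \<in> Obj (Cx N). \<lambda>(A, x) \<in> el (sum_psh N X) \<Gamma>. (A, \<theta> (ext N \<Gamma> A) x))"

definition Pi_hat ::
  "('o, 'm, 'ty, 'tm) nat_model \<Rightarrow> ('o \<Rightarrow> 'ty \<Rightarrow> 'ty \<Rightarrow> 'ty) \<Rightarrow> 'o \<Rightarrow> 'ty \<times> 'ty \<Rightarrow> 'ty" where
  "Pi_hat N pi = (\<lambda>\<Gamma> \<in> Obj (Cx N). \<lambda>(A, B) \<in> el (sum_psh N (Ty N)) \<Gamma>. pi \<Gamma> A B)"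

definition lam_hat ::
  "('o, 'm, 'ty, 'tm) nat_model \<Rightarrow> ('o \<Rightarrow> 'ty \<Rightarrow> 'ty \<Rightarrow> 'tm \<Rightarrow> 'tm) \<Rightarrow> 'o \<Rightarrow> 'ty \<times> 'tm \<Rightarrow> 'tm" where
  "lam_hat N lam =
     (\<lambda>\<Gamma> \<in> Obj (Cx N). \<lambda>(A, b) \<in> el (sum_psh N (Tm N)) \<Gamma>. lam \<Gamma> A (tp N (ext N \<Gamma> A) b) b)"

end

theory Submission imports Defs begin

text \<open>
  By the Yoneda lemma, the square is a pullback iff it is one pointwise, that is, iff for all
  \<open>\<Gamma>\<close>, \<open>A\<close> and \<open>B\<close> the operation \<open>lambda\<close> is a bijection from the terms of type \<open>B\<close> over
  \<open>\<Gamma> \<cdot> A\<close> to the terms of type \<open>pi(A, B)\<close> over \<open>\<Gamma>\<close>. In a model the inverse sends \<open>f\<close> to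
  \<open>app(f[p], q)\<close>: one composite is the identity by the eta rule, the other one by the beta rule
  and \<open>(p \<cdot> A) \<circ> s(q) = id\<close>. Conversely the beta rule forces \<open>app(f, a) = b[s(a)]\<close> for the
  unique \<open>b\<close> with \<open>lambda(b) = f\<close>; this is stable under substitution because
  \<open>(\<sigma> \<cdot> A) \<circ> s(a[\<sigma>]) = s(a) \<circ> \<sigma>\<close>. Both identities hold since a map into
  \<open>\<Gamma> \<cdot> A\<close> is determined by its composite with \<open>p\<close> and its action on \<open>q\<close>.
\<close>

section \<open>Pointwise pullbacks of presheaves\<close>

context category
begin

lemma hom_obj: "f \<in> hom C X Y \<Longrightarrow> X \<in> Obj C" "f \<in> hom C X Y \<Longrightarrow> Y \<in> Obj C"
  by (auto simp: hom_def dom_obj cod_obj)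

end

lemma hom_arr: "f \<in> hom C X Y \<Longrightarrow> f \<in> Arr C"
  by (simp add: hom_def)

section \<open>Natural transformations as extensional families, and their vertical
  composites\<close>

lemma nat_trans_el:
  "nat_trans C F G \<eta> \<Longrightarrow> \<Gamma> \<in> Obj C \<Longrightarrow> x \<in> el F \<Gamma> \<Longrightarrow> \<eta> \<Gamma> x \<in> el G \<Gamma>"
  unfolding nat_trans_def by (blast dest: PiE_mem)

lemma nat_trans_act:
  assumes "nat_trans C F G \<eta>" "\<sigma> \<in> hom C \<Delta> \<Gamma>" "x \<in> el F \<Gamma>"
  shows "\<eta> \<Delta> (act F \<sigma> x) = act G \<sigma> (\<eta> \<Gamma> x)"
proof -
  interpret presheaf C F using assms(1) by (simp add: nat_trans_def)
  show ?thesis using assms hom_obj[OF assms(2)] unfolding nat_trans_def by blast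
qed

lemma nat_trans_presheaf:
  assumes "nat_trans C F G \<eta>"
  shows "presheaf C F" "presheaf C G"
  using assms by (auto simp: nat_trans_def)

lemma nat_transI:
  assumes "presheaf C F" "presheaf C G"
    and "\<And>\<Gamma> x. \<Gamma> \<in> Obj C \<Longrightarrow> x \<in> el F \<Gamma> \<Longrightarrow> \<eta> \<Gamma> x \<in> el G \<Gamma>"
    and "\<And>\<sigma> \<Delta> \<Gamma> x. \<sigma> \<in> hom C \<Delta> \<Gamma> \<Longrightarrow> x \<in> el F \<Gamma> \<Longrightarrow> \<eta> \<Delta> (act F \<sigma> x) = act G \<sigma> (\<eta> \<Gamma> x)"
  shows "nat_trans C F G (\<lambda>\<Gamma> \<in> Obj C. \<lambda>x \<in> el F \<Gamma>. \<eta> \<Gamma> x)"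
proof -
  interpret presheaf C F by fact
  show ?thesis
    unfolding nat_trans_def using assms act_el by (auto simp: restrict_PiE_iff)
qed

text \<open>Outside \<open>S\<close> and \<open>T x\<close> both functions are
  \<open>undefined\<close>, so agreement on the common domain suffices. The codomains may differ, so
  that a composite can be compared with a typed transformation.\<close>

lemma ext2_eqI:
  assumes "f \<in> (\<Pi>\<^sub>E x \<in> S. T x \<rightarrow>\<^sub>E U x)" "g \<in> (\<Pi>\<^sub>E x \<in> S. T x \<rightarrow>\<^sub>E V x)"
    and "\<And>x y. x \<in> S \<Longrightarrow> y \<in> T x \<Longrightarrow> f x y = g x y"
  shows "f = g"
proof (intro ext)
  fix x y
  show "f x y = g x y"
  proof (cases "x \<in> S \<and> y \<in> T x")
    case False
    then consider "x \<notin> S" | "x \<in> S" "y \<notin> T x" by blast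
    then show ?thesis
    proof cases
      case 1
      then show ?thesis using PiE_arb[OF assms(1)] PiE_arb[OF assms(2)] by simp
    next
      case 2
      then show ?thesis
        using PiE_arb[OF PiE_mem[OF assms(1) 2(1)]] PiE_arb[OF PiE_mem[OF assms(2) 2(1)]] by simp
    qed
  qed (use assms(3) in auto)
qed

lemma nat_trans_eqI:
  assumes "nat_trans C F G \<eta>" "nat_trans C F G' \<theta>"
    and "\<And>\<Gamma> x. \<Gamma> \<in> Obj C \<Longrightarrow> x \<in> el F \<Gamma> \<Longrightarrow> \<eta> \<Gamma> x = \<theta> \<Gamma> x"
  shows "\<eta> = \<theta>"
  using ext2_eqI[of \<eta> "Obj C" "el F" "el G" \<theta> "el G'"] assms
  unfolding nat_trans_def by blast

lemma vcomp_apply: "\<Gamma> \<in> Obj C \<Longrightarrow> x \<in> el F \<Gamma> \<Longrightarrow> vcomp C F \<theta> \<eta> \<Gamma> x = \<theta> \<Gamma> (\<eta> \<Gamma> x)"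
  by (simp add: vcomp_def compose_def)

text \<open>The codomain is \<open>UNIV\<close> because \<theta> and \<eta> are arbitrary functions
  here; only the extensionality of the composite is recorded.\<close>

lemma vcomp_ext: "vcomp C F \<theta> \<eta> \<in> (\<Pi>\<^sub>E \<Gamma> \<in> Obj C. el F \<Gamma> \<rightarrow>\<^sub>E UNIV)"
  by (auto simp: vcomp_def compose_def restrict_PiE_iff)

lemma vcomp_eq_iff:
  "vcomp C F \<theta> \<eta> = vcomp C F \<theta>' \<eta>' \<longleftrightarrow>
   (\<forall>\<Gamma> \<in> Obj C. \<forall>x \<in> el F \<Gamma>. \<theta> \<Gamma> (\<eta> \<Gamma> x) = \<theta>' \<Gamma> (\<eta>' \<Gamma> x))" (is "?l = ?r")
proof
  show "?l \<Longrightarrow> ?r" by (metis vcomp_apply)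
  show "?r \<Longrightarrow> ?l" by (rule ext2_eqI[OF vcomp_ext vcomp_ext]) (simp add: vcomp_apply)
qed

lemma vcomp_eq_nat_trans_iff:
  assumes "nat_trans C F G \<zeta>"
  shows "vcomp C F \<theta> \<eta> = \<zeta> \<longleftrightarrow> (\<forall>\<Gamma> \<in> Obj C. \<forall>x \<in> el F \<Gamma>. \<theta> \<Gamma> (\<eta> \<Gamma> x) = \<zeta> \<Gamma> x)"
    (is "?l = ?r")
proof
  show "?l \<Longrightarrow> ?r" by (metis vcomp_apply)
  assume ?r
  then show ?l using assms
    by (intro ext2_eqI[OF vcomp_ext, of \<zeta> C F "el G"]) (auto simp: vcomp_apply nat_trans_def)
qed

text \<open>Unique existence at each object defines the mediating map pointwise; the same uniqueness
  yields its naturality and rules out any other mediating map.\<close>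

lemma is_pullbackI:
  assumes tt: "nat_trans C P X tt" and ll: "nat_trans C P Y ll"
    and rr: "nat_trans C X Z rr" and bb: "nat_trans C Y Z bb"
    and sq: "\<And>\<Gamma> p. \<Gamma> \<in> Obj C \<Longrightarrow> p \<in> el P \<Gamma> \<Longrightarrow> rr \<Gamma> (tt \<Gamma> p) = bb \<Gamma> (ll \<Gamma> p)"
    and ex1: "\<And>\<Gamma> x y. \<Gamma> \<in> Obj C \<Longrightarrow> x \<in> el X \<Gamma> \<Longrightarrow> y \<in> el Y \<Gamma> \<Longrightarrow> rr \<Gamma> x = bb \<Gamma> y \<Longrightarrow>
      \<exists>!p. p \<in> el P \<Gamma> \<and> tt \<Gamma> p = x \<and> ll \<Gamma> p = y"
  shows "is_pullback \<U> C P X Y Z tt ll rr bb"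
proof -
  interpret P: presheaf C P using nat_trans_presheaf[OF tt] by simp
  have "\<exists>!h. nat_trans C Q P h \<and> vcomp C Q tt h = f \<and> vcomp C Q ll h = g"
    if f: "nat_trans C Q X f" and g: "nat_trans C Q Y g" and c: "vcomp C Q rr f = vcomp C Q bb g"
    for Q :: "('a, 'b, 'x) psh" and f g
  proof -
    interpret Q: presheaf C Q using nat_trans_presheaf[OF f] by simp
    define med where "med \<Gamma> q = (THE p. p \<in> el P \<Gamma> \<and> tt \<Gamma> p = f \<Gamma> q \<and> ll \<Gamma> p = g \<Gamma> q)" for \<Gamma> q
    have ex1': "\<exists>!p. p \<in> el P \<Gamma> \<and> tt \<Gamma> p = f \<Gamma> q \<and> ll \<Gamma> p = g \<Gamma> q"
      if "\<Gamma> \<in> Obj C" "q \<in> el Q \<Gamma>" for \<Gamma> q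
      using c[unfolded vcomp_eq_iff] that
      by (intro ex1 nat_trans_el[OF f] nat_trans_el[OF g]) auto
    have med: "med \<Gamma> q \<in> el P \<Gamma>" "tt \<Gamma> (med \<Gamma> q) = f \<Gamma> q" "ll \<Gamma> (med \<Gamma> q) = g \<Gamma> q"
      if "\<Gamma> \<in> Obj C" "q \<in> el Q \<Gamma>" for \<Gamma> q
      using theI'[OF ex1'[OF that]] by (auto simp: med_def)
    have med_nat: "nat_trans C Q P (\<lambda>\<Gamma> \<in> Obj C. \<lambda>q \<in> el Q \<Gamma>. med \<Gamma> q)"
    proof (rule nat_transI)
      fix \<sigma> \<Delta> \<Gamma> q
      assume s: "\<sigma> \<in> hom C \<Delta> \<Gamma>" and q: "q \<in> el Q \<Gamma>"
      note o = P.hom_obj[OF s]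
      \<comment> \<open>Restricting the chosen point along \<sigma> gives a point with the
        properties that characterise \<open>med\<close> at the restricted \<open>q\<close>, so the
        two coincide.\<close>
      have "act P \<sigma> (med \<Gamma> q) \<in> el P \<Delta>"
           "tt \<Delta> (act P \<sigma> (med \<Gamma> q)) = f \<Delta> (act Q \<sigma> q)"
           "ll \<Delta> (act P \<sigma> (med \<Gamma> q)) = g \<Delta> (act Q \<sigma> q)"
        using med[OF o(2) q] s q
        by (simp_all add: P.act_el nat_trans_act[OF tt s] nat_trans_act[OF ll s]
            nat_trans_act[OF f s] nat_trans_act[OF g s])
      then show "med \<Delta> (act Q \<sigma> q) = act P \<sigma> (med \<Gamma> q)"
        using ex1'[OF o(1) Q.act_el[OF s q]] med[OF o(1) Q.act_el[OF s q]] by blast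
    qed (use med P.presheaf_axioms Q.presheaf_axioms in auto)
    show ?thesis
    proof (rule ex1I)
      show "nat_trans C Q P (\<lambda>\<Gamma> \<in> Obj C. \<lambda>q \<in> el Q \<Gamma>. med \<Gamma> q) \<and>
        vcomp C Q tt (\<lambda>\<Gamma> \<in> Obj C. \<lambda>q \<in> el Q \<Gamma>. med \<Gamma> q) = f \<and>
        vcomp C Q ll (\<lambda>\<Gamma> \<in> Obj C. \<lambda>q \<in> el Q \<Gamma>. med \<Gamma> q) = g"
        using med_nat med by (simp add: vcomp_eq_nat_trans_iff[OF f] vcomp_eq_nat_trans_iff[OF g])
    next
      fix h
      assume h: "nat_trans C Q P h \<and> vcomp C Q tt h = f \<and> vcomp C Q ll h = g"
      show "h = (\<lambda>\<Gamma> \<in> Obj C. \<lambda>q \<in> el Q \<Gamma>. med \<Gamma> q)"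
      proof (rule nat_trans_eqI[where G = P, OF _ med_nat])
        fix \<Gamma> q assume q: "\<Gamma> \<in> Obj C" "q \<in> el Q \<Gamma>"
        \<comment> \<open>Evaluated at \<open>q\<close>, the two equations for \<open>h\<close> are
          the defining property of \<open>med\<close>.\<close>
        have "h \<Gamma> q \<in> el P \<Gamma> \<and> tt \<Gamma> (h \<Gamma> q) = f \<Gamma> q \<and> ll \<Gamma> (h \<Gamma> q) = g \<Gamma> q"
          using h q nat_trans_el[of C Q P h]
          by (simp add: vcomp_eq_nat_trans_iff[OF f] vcomp_eq_nat_trans_iff[OF g])
        then have "h \<Gamma> q = med \<Gamma> q"
          using ex1'[OF q] med[OF q] by blast
        then show "h \<Gamma> q = (\<lambda>\<Gamma> \<in> Obj C. \<lambda>q \<in> el Q \<Gamma>. med \<Gamma> q) \<Gamma> q"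
          using q by simp
      qed (use h in simp)
    qed
  qed
  then show ?thesis
    using tt ll rr bb sq unfolding is_pullback_def vcomp_eq_iff by blast
qed

lemma is_pullback_square:
  assumes "is_pullback \<U> C P X Y Z tt ll rr bb" "\<Gamma> \<in> Obj C" "p \<in> el P \<Gamma>"
  shows "rr \<Gamma> (tt \<Gamma> p) = bb \<Gamma> (ll \<Gamma> p)"
  using assms unfolding is_pullback_def vcomp_eq_iff by blast

text \<open>The universal property is tested on a copy, inside the universe, of a representable.\<close>

lemma is_pullback_pointwise:
  fixes \<U> :: "'x itself"
  assumes pb: "is_pullback \<U> C P X Y Z tt ll rr bb" and small: "small \<U> C"
    and \<Gamma>: "\<Gamma> \<in> Obj C" and x: "x \<in> el X \<Gamma>" and y: "y \<in> el Y \<Gamma>" and xy: "rr \<Gamma> x = bb \<Gamma> y"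
  shows "\<exists>!p. p \<in> el P \<Gamma> \<and> tt \<Gamma> p = x \<and> ll \<Gamma> p = y"
proof -
  have tt: "nat_trans C P X tt" and ll: "nat_trans C P Y ll"
    and rr: "nat_trans C X Z rr" and bb: "nat_trans C Y Z bb"
    using pb by (auto simp: is_pullback_def)
  interpret P: presheaf C P using nat_trans_presheaf[OF tt] by simp
  interpret X: presheaf C X using nat_trans_presheaf[OF tt] by simp
  interpret Y: presheaf C Y using nat_trans_presheaf[OF ll] by simp
  obtain i :: "_ \<Rightarrow> 'x" where i: "inj_on i (Arr C)" using small by (auto simp: small_def)
  define j where "j = inv_into (Arr C) i"
  have ji [simp]: "j (i \<sigma>) = \<sigma>" if "\<sigma> \<in> hom C \<Delta> \<Theta>" for \<sigma> \<Delta> \<Theta>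
    using i that by (simp add: j_def hom_arr)
  \<comment> \<open>\<open>Q\<close> is the representable on \<Gamma> transported along the indexing
    \<open>i\<close>: \<open>j\<close> decodes an element to an arrow, and the action is
    precomposition.\<close>
  define Q :: "(_, _, 'x) psh" where
    "Q = \<lparr>el = (\<lambda>\<Delta>. i ` hom C \<Delta> \<Gamma>), act = (\<lambda>\<sigma> z. i (cmp C (j z) \<sigma>))\<rparr>"
  have [simp]: "el Q = (\<lambda>\<Delta>. i ` hom C \<Delta> \<Gamma>)" "act Q = (\<lambda>\<sigma> z. i (cmp C (j z) \<sigma>))"
    by (simp_all add: Q_def)
  interpret Q: presheaf C Q
    apply unfold_locales
    subgoal by (auto intro: P.cmp_hom)
    subgoal by (auto simp: P.cmp_idt_right)
    subgoal by (auto simp: P.cmp_assoc P.cmp_hom ji[OF P.cmp_hom])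
    done
  \<comment> \<open>The Yoneda map of an element \<open>z\<close>, precomposed with decoding; it is
    stated for any \<open>F\<close> so as to serve \<open>P\<close>, \<open>X\<close> and
    \<open>Y\<close>.\<close>
  have k_nat: "nat_trans C Q F (\<lambda>\<Delta> \<in> Obj C. \<lambda>q \<in> el Q \<Delta>. act F (j q) z)"
    if "presheaf C F" "z \<in> el F \<Gamma>" for F :: "(_, _, 'w) psh" and z
  proof -
    interpret F: presheaf C F by fact
    show ?thesis
      using that(2) Q.presheaf_axioms F.presheaf_axioms
      by (intro nat_transI) (auto simp: F.act_el F.act_cmp ji[OF P.cmp_hom])
  qed
  let ?kP = "\<lambda>z. \<lambda>\<Delta> \<in> Obj C. \<lambda>q \<in> el Q \<Delta>. act P (j q) z"
  let ?kX = "\<lambda>\<Delta> \<in> Obj C. \<lambda>q \<in> el Q \<Delta>. act X (j q) x"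
  let ?kY = "\<lambda>\<Delta> \<in> Obj C. \<lambda>q \<in> el Q \<Delta>. act Y (j q) y"
  have kX: "nat_trans C Q X ?kX" and kY: "nat_trans C Q Y ?kY"
    by (rule k_nat[OF X.presheaf_axioms x], rule k_nat[OF Y.presheaf_axioms y])
  \<comment> \<open>Both composites send an arrow to the restriction along it of the common value
    \<open>rr \<Gamma> x = bb \<Gamma> y\<close>.\<close>
  have "vcomp C Q rr ?kX = vcomp C Q bb ?kY"
    using x y xy by (auto simp: vcomp_eq_iff nat_trans_act[OF rr] nat_trans_act[OF bb])
  then have ex1: "\<exists>!h. nat_trans C Q P h \<and> vcomp C Q tt h = ?kX \<and> vcomp C Q ll h = ?kY"
    using pb kX kY unfolding is_pullback_def by blast
  then obtain h where h: "nat_trans C Q P h" "vcomp C Q tt h = ?kX" "vcomp C Q ll h = ?kY"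
    by blast
  \<comment> \<open>The code of the identity is the generic element: evaluating \<open>h\<close>
    there produces the required point.\<close>
  let ?u = "i (idt C \<Gamma>)"
  have u: "?u \<in> el Q \<Gamma>" using P.idt_hom[OF \<Gamma>] by simp
  have jid [simp]: "j ?u = idt C \<Gamma>" using P.idt_hom[OF \<Gamma>] by simp
  show ?thesis
  proof (rule ex1I)
    show "h \<Gamma> ?u \<in> el P \<Gamma> \<and> tt \<Gamma> (h \<Gamma> ?u) = x \<and> ll \<Gamma> (h \<Gamma> ?u) = y"
      using nat_trans_el[OF h(1) \<Gamma> u] h(2,3)[unfolded vcomp_eq_nat_trans_iff[OF kX]
          vcomp_eq_nat_trans_iff[OF kY], rule_format, OF \<Gamma> u] \<Gamma> u x y
      by (simp add: X.act_idt Y.act_idt)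
  next
    fix p
    assume p: "p \<in> el P \<Gamma> \<and> tt \<Gamma> p = x \<and> ll \<Gamma> p = y"
    \<comment> \<open>Any candidate \<open>p\<close> induces a mediating map, which must be
      \<open>h\<close>; evaluation at the identity then recovers \<open>p\<close>.\<close>
    have "nat_trans C Q P (?kP p)" using p by (intro k_nat P.presheaf_axioms) simp
    moreover have "vcomp C Q tt (?kP p) = ?kX" "vcomp C Q ll (?kP p) = ?kY"
      unfolding vcomp_eq_nat_trans_iff[OF kX] vcomp_eq_nat_trans_iff[OF kY]
      using p by (auto simp: nat_trans_act[OF tt] nat_trans_act[OF ll])
    ultimately have "?kP p = h" using ex1 h by blast
    then have "?kP p \<Gamma> ?u = h \<Gamma> ?u" by simp
    then show "p = h \<Gamma> ?u" using \<Gamma> u p by (simp add: P.act_idt)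
  qed
qed

section \<open>Substitution calculus of a natural model\<close>

context natural_model
begin

abbreviation (input) "\<C> \<equiv> Cx N"

sublocale Ty: presheaf "Cx N" "Ty N"
  using nat_trans_presheaf[OF tp_nat] by simp

sublocale Tm: presheaf "Cx N" "Tm N"
  using nat_trans_presheaf[OF tp_nat] by simp

section \<open>Typing of terms and the universal property of context extension\<close>

lemma tms_el: "a \<in> tms N \<Gamma> A \<Longrightarrow> a \<in> el (Tm N) \<Gamma>"
  by (simp add: tms_def)

lemma tms_tp: "a \<in> tms N \<Gamma> A \<Longrightarrow> tp N \<Gamma> a = A"
  by (simp add: tms_def)

lemma tms_act:
  "\<sigma> \<in> hom \<C> \<Delta> \<Gamma> \<Longrightarrow> a \<in> tms N \<Gamma> A \<Longrightarrow> act (Tm N) \<sigma> a \<in> tms N \<Delta> (act (Ty N) \<sigma> A)"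
  by (simp add: tms_def Tm.act_el nat_trans_act[OF tp_nat])

text \<open>This files a term over the extended context under its own type, which is the
  \<open>B\<close> that \<open>lam_hat\<close> supplies.\<close>

lemma tm_ext_typing: "\<Gamma> \<in> Obj \<C> \<Longrightarrow> A \<in> el (Ty N) \<Gamma> \<Longrightarrow> b \<in> el (Tm N) (ext N \<Gamma> A) \<Longrightarrow>
  tp N (ext N \<Gamma> A) b \<in> el (Ty N) (ext N \<Gamma> A) \<and> b \<in> tms N (ext N \<Gamma> A) (tp N (ext N \<Gamma> A) b)"
  by (auto simp: tms_def intro: nat_trans_el[OF tp_nat] ext_obj)

text \<open>Commutativity of the extension square, evaluated at the identity of the extended
  context, computes the type of the variable.\<close>

lemma var_tms:
  assumes "\<Gamma> \<in> Obj \<C>" "A \<in> el (Ty N) \<Gamma>"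
  shows "var N \<Gamma> A \<in> tms N (ext N \<Gamma> A) (act (Ty N) (wk N \<Gamma> A) A)"
proof -
  note w = wk_hom[OF assms] and e = ext_obj[OF assms]
  have dom: "Dom \<C> (wk N \<Gamma> A) = ext N \<Gamma> A" using w by (simp add: hom_def)
  have "idt \<C> (ext N \<Gamma> A) \<in> el (yo \<C> (ext N \<Gamma> A)) (ext N \<Gamma> A)"
    using idt_hom[OF e] by (simp add: yo_def)
  from is_pullback_square[OF ext_pullback[OF assms] e this] show ?thesis
    using e idt_hom[OF e] w var_el[OF assms]
    by (simp add: yo_el_def yo_map_def dom Tm.act_idt cmp_idt_right tms_def)
qed

text \<open>The extension square is a pullback at \<Delta>, where the elements of the representables
  are the arrows out of \<Delta>. The typing of \<open>a\<close> says that \<open>a\<close> and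
  \<sigma> agree in \<open>Ty N\<close>.\<close>

lemma comprehension:
  assumes s: "\<sigma> \<in> hom \<C> \<Delta> \<Gamma>" and A: "A \<in> el (Ty N) \<Gamma>" and a: "a \<in> tms N \<Delta> (act (Ty N) \<sigma> A)"
  shows "\<exists>!\<tau>. \<tau> \<in> hom \<C> \<Delta> (ext N \<Gamma> A) \<and> cmp \<C> (wk N \<Gamma> A) \<tau> = \<sigma> \<and> act (Tm N) \<tau> (var N \<Gamma> A) = a"
proof -
  note o = hom_obj[OF s]
  have dom: "Dom \<C> (wk N \<Gamma> A) = ext N \<Gamma> A" using wk_hom[OF o(2) A] by (simp add: hom_def)
  have "\<exists>!\<tau>. \<tau> \<in> el (yo \<C> (ext N \<Gamma> A)) \<Delta> \<and>
      yo_el \<C> (Tm N) (ext N \<Gamma> A) (var N \<Gamma> A) \<Delta> \<tau> = a \<and> yo_map \<C> (wk N \<Gamma> A) \<Delta> \<tau> = \<sigma>"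
    by (rule is_pullback_pointwise[OF ext_pullback[OF o(2) A] small o(1)])
       (use s a o in \<open>auto simp: yo_def yo_el_def tms_def\<close>)
  moreover have "\<tau> \<in> el (yo \<C> (ext N \<Gamma> A)) \<Delta> \<and>
      yo_el \<C> (Tm N) (ext N \<Gamma> A) (var N \<Gamma> A) \<Delta> \<tau> = a \<and> yo_map \<C> (wk N \<Gamma> A) \<Delta> \<tau> = \<sigma> \<longleftrightarrow>
      \<tau> \<in> hom \<C> \<Delta> (ext N \<Gamma> A) \<and> cmp \<C> (wk N \<Gamma> A) \<tau> = \<sigma> \<and> act (Tm N) \<tau> (var N \<Gamma> A) = a" for \<tau>
    using o by (auto simp: yo_def yo_el_def yo_map_def dom)
  ultimately show ?thesis by simp
qed

lemma pair_props:
  assumes s: "\<sigma> \<in> hom \<C> \<Delta> \<Gamma>" and A: "A \<in> el (Ty N) \<Gamma>" and a: "a \<in> tms N \<Delta> (act (Ty N) \<sigma> A)"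
  shows "pair N \<sigma> A a \<in> hom \<C> \<Delta> (ext N \<Gamma> A)"
    and "cmp \<C> (wk N \<Gamma> A) (pair N \<sigma> A a) = \<sigma>"
    and "act (Tm N) (pair N \<sigma> A a) (var N \<Gamma> A) = a"
proof -
  have "Dom \<C> \<sigma> = \<Delta>" "Cod \<C> \<sigma> = \<Gamma>" using s by (auto simp: hom_def)
  then show "pair N \<sigma> A a \<in> hom \<C> \<Delta> (ext N \<Gamma> A)"
    and "cmp \<C> (wk N \<Gamma> A) (pair N \<sigma> A a) = \<sigma>"
    and "act (Tm N) (pair N \<sigma> A a) (var N \<Gamma> A) = a"
    using theI'[OF comprehension[OF assms]] by (simp_all add: pair_def Let_def)
qed

text \<open>The uniqueness half of \<open>comprehension\<close>, in the form used for all equations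
  between substitutions below: compare composites with \<open>wk\<close>, then actions on
  \<open>var\<close>.\<close>

lemma ext_hom_eqI:
  assumes A: "A \<in> el (Ty N) \<Gamma>" and \<Gamma>: "\<Gamma> \<in> Obj \<C>"
    and f: "f \<in> hom \<C> \<Delta> (ext N \<Gamma> A)" and g: "g \<in> hom \<C> \<Delta> (ext N \<Gamma> A)"
    and w: "cmp \<C> (wk N \<Gamma> A) f = cmp \<C> (wk N \<Gamma> A) g"
    and v: "act (Tm N) f (var N \<Gamma> A) = act (Tm N) g (var N \<Gamma> A)"
  shows "f = g"
proof -
  note wk = wk_hom[OF \<Gamma> A]
  \<comment> \<open>The common action on the variable has the type that \<open>comprehension\<close>
    demands over the composite \<open>cmp \<C> (wk N \<Gamma> A) f\<close>.\<close>
  have "act (Tm N) f (var N \<Gamma> A) \<in> tms N \<Delta> (act (Ty N) (cmp \<C> (wk N \<Gamma> A) f) A)"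
    using tms_act[OF f var_tms[OF \<Gamma> A]] by (simp add: Ty.act_cmp[OF f wk A])
  from comprehension[OF cmp_hom[OF f wk] A this] show ?thesis
    using f g w v by metis
qed

section \<open>Sections and lifted substitutions\<close>

lemma sect_props:
  assumes \<Gamma>: "\<Gamma> \<in> Obj \<C>" and A: "A \<in> el (Ty N) \<Gamma>" and a: "a \<in> tms N \<Gamma> A"
  shows "sect N \<Gamma> A a \<in> hom \<C> \<Gamma> (ext N \<Gamma> A)"
    and "cmp \<C> (wk N \<Gamma> A) (sect N \<Gamma> A a) = idt \<C> \<Gamma>"
    and "act (Tm N) (sect N \<Gamma> A a) (var N \<Gamma> A) = a"
  using pair_props[OF idt_hom[OF \<Gamma>] A] a by (simp_all add: sect_def Ty.act_idt[OF \<Gamma> A])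

lemma lift_props:
  assumes s: "\<sigma> \<in> hom \<C> \<Delta> \<Gamma>" and A: "A \<in> el (Ty N) \<Gamma>"
  defines "A' \<equiv> act (Ty N) \<sigma> A"
  shows "lift N \<sigma> A \<in> hom \<C> (ext N \<Delta> A') (ext N \<Gamma> A)"
    and "cmp \<C> (wk N \<Gamma> A) (lift N \<sigma> A) = cmp \<C> \<sigma> (wk N \<Delta> A')"
    and "act (Tm N) (lift N \<sigma> A) (var N \<Gamma> A) = var N \<Delta> A'"
proof -
  have A': "A' \<in> el (Ty N) \<Delta>" using s A by (simp add: A'_def Ty.act_el)
  note \<Delta> = hom_obj(1)[OF s]
  note wk = wk_hom[OF \<Delta> A']
  \<comment> \<open>Weakening \<open>A'\<close> is the same as substituting in \<open>A\<close>
    along \<sigma> after \<open>wk\<close>, so the variable can be paired with that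
    composite.\<close>
  have v: "var N \<Delta> A' \<in> tms N (ext N \<Delta> A') (act (Ty N) (cmp \<C> \<sigma> (wk N \<Delta> A')) A)"
    using var_tms[OF \<Delta> A'] by (simp add: Ty.act_cmp[OF wk[unfolded A'_def] s A] A'_def)
  have "lift N \<sigma> A = pair N (cmp \<C> \<sigma> (wk N \<Delta> A')) A (var N \<Delta> A')"
    using s by (simp add: lift_def A'_def hom_def Let_def)
  then show "lift N \<sigma> A \<in> hom \<C> (ext N \<Delta> A') (ext N \<Gamma> A)"
    and "cmp \<C> (wk N \<Gamma> A) (lift N \<sigma> A) = cmp \<C> \<sigma> (wk N \<Delta> A')"
    and "act (Tm N) (lift N \<sigma> A) (var N \<Gamma> A) = var N \<Delta> A'"
    using pair_props[OF cmp_hom[OF wk s] A v] by simp_all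
qed

lemma lift_idt:
  assumes \<Gamma>: "\<Gamma> \<in> Obj \<C>" and A: "A \<in> el (Ty N) \<Gamma>"
  shows "lift N (idt \<C> \<Gamma>) A = idt \<C> (ext N \<Gamma> A)"
proof (rule ext_hom_eqI[OF A \<Gamma>])
  note l = lift_props[OF idt_hom[OF \<Gamma>] A, unfolded Ty.act_idt[OF \<Gamma> A]]
  note w = wk_hom[OF \<Gamma> A]
  show "lift N (idt \<C> \<Gamma>) A \<in> hom \<C> (ext N \<Gamma> A) (ext N \<Gamma> A)" by (rule l)
  show "idt \<C> (ext N \<Gamma> A) \<in> hom \<C> (ext N \<Gamma> A) (ext N \<Gamma> A)" by (rule idt_hom[OF ext_obj[OF \<Gamma> A]])
  show "cmp \<C> (wk N \<Gamma> A) (lift N (idt \<C> \<Gamma>) A) = cmp \<C> (wk N \<Gamma> A) (idt \<C> (ext N \<Gamma> A))"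
    by (simp add: l cmp_idt_left[OF w] cmp_idt_right[OF w])
  show "act (Tm N) (lift N (idt \<C> \<Gamma>) A) (var N \<Gamma> A) = act (Tm N) (idt \<C> (ext N \<Gamma> A)) (var N \<Gamma> A)"
    by (simp add: l Tm.act_idt[OF ext_obj[OF \<Gamma> A] var_el[OF \<Gamma> A]])
qed

text \<open>Pasting the two lifting squares gives equal composites with \<open>wk\<close>, and both
  sides send the variable of \<open>A\<close> to that of the twice substituted type. With
  \<open>lift_idt\<close> this makes \<open>sum_psh\<close> functorial.\<close>

lemma lift_cmp:
  assumes t: "\<tau> \<in> hom \<C> \<Theta> \<Delta>" and s: "\<sigma> \<in> hom \<C> \<Delta> \<Gamma>" and A: "A \<in> el (Ty N) \<Gamma>"
  shows "lift N (cmp \<C> \<sigma> \<tau>) A = cmp \<C> (lift N \<sigma> A) (lift N \<tau> (act (Ty N) \<sigma> A))"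
proof -
  note o = hom_obj[OF s] hom_obj[OF t]
  define A' where "A' = act (Ty N) \<sigma> A"
  define A'' where "A'' = act (Ty N) \<tau> A'"
  have A': "A' \<in> el (Ty N) \<Delta>" using s A by (simp add: A'_def Ty.act_el)
  have A'': "A'' \<in> el (Ty N) \<Theta>" using t A' by (simp add: A''_def Ty.act_el)
  note ls = lift_props[OF s A, folded A'_def]
  note lt = lift_props[OF t A', folded A''_def]
  have "act (Ty N) (cmp \<C> \<sigma> \<tau>) A = A''" using t s A by (simp add: A'_def A''_def Ty.act_cmp)
  note lst = lift_props[OF cmp_hom[OF t s] A, unfolded this]
  have "lift N (cmp \<C> \<sigma> \<tau>) A = cmp \<C> (lift N \<sigma> A) (lift N \<tau> A')"
  proof (rule ext_hom_eqI[OF A o(2) lst(1) cmp_hom[OF lt(1) ls(1)]])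
    have "cmp \<C> (wk N \<Gamma> A) (cmp \<C> (lift N \<sigma> A) (lift N \<tau> A'))
        = cmp \<C> (cmp \<C> \<sigma> (wk N \<Delta> A')) (lift N \<tau> A')"
      using cmp_assoc[OF lt(1) ls(1) wk_hom[OF o(2) A]] ls(2) by simp
    also have "\<dots> = cmp \<C> \<sigma> (cmp \<C> \<tau> (wk N \<Theta> A''))"
      using cmp_assoc[OF lt(1) wk_hom[OF o(1) A'] s] lt(2) by simp
    also have "\<dots> = cmp \<C> (cmp \<C> \<sigma> \<tau>) (wk N \<Theta> A'')"
      using cmp_assoc[OF wk_hom[OF o(3) A''] t s] by simp
    finally show "cmp \<C> (wk N \<Gamma> A) (lift N (cmp \<C> \<sigma> \<tau>) A)
        = cmp \<C> (wk N \<Gamma> A) (cmp \<C> (lift N \<sigma> A) (lift N \<tau> A'))"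
      using lst(2) by simp
    show "act (Tm N) (lift N (cmp \<C> \<sigma> \<tau>) A) (var N \<Gamma> A)
        = act (Tm N) (cmp \<C> (lift N \<sigma> A) (lift N \<tau> A')) (var N \<Gamma> A)"
      using lst(3) ls(3) lt(3) Tm.act_cmp[OF lt(1) ls(1) var_el[OF o(2) A]] by simp
  qed
  then show ?thesis by (simp add: A'_def)
qed

text \<open>Composing with \<open>wk\<close> turns both sides into \<sigma>, and acting on the
  variable turns both into \<open>act (Tm N) \<sigma> a\<close>. This gives stability of application
  under substitution.\<close>

lemma lift_sect:
  assumes s: "\<sigma> \<in> hom \<C> \<Delta> \<Gamma>" and A: "A \<in> el (Ty N) \<Gamma>" and a: "a \<in> tms N \<Gamma> A"
  shows "cmp \<C> (lift N \<sigma> A) (sect N \<Delta> (act (Ty N) \<sigma> A) (act (Tm N) \<sigma> a))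
      = cmp \<C> (sect N \<Gamma> A a) \<sigma>"
proof -
  note o = hom_obj[OF s]
  have A': "act (Ty N) \<sigma> A \<in> el (Ty N) \<Delta>" using s A by (simp add: Ty.act_el)
  note l = lift_props[OF s A]
  note sa = sect_props[OF o(2) A a]
  note sa' = sect_props[OF o(1) A' tms_act[OF s a]]
  note v = var_el[OF o(2) A] and w = wk_hom[OF o(2) A] and w' = wk_hom[OF o(1) A']
  show ?thesis
  proof (rule ext_hom_eqI[OF A o(2) cmp_hom[OF sa'(1) l(1)] cmp_hom[OF s sa(1)]])
    show "cmp \<C> (wk N \<Gamma> A) (cmp \<C> (lift N \<sigma> A) (sect N \<Delta> (act (Ty N) \<sigma> A) (act (Tm N) \<sigma> a)))
        = cmp \<C> (wk N \<Gamma> A) (cmp \<C> (sect N \<Gamma> A a) \<sigma>)"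
      using cmp_assoc[OF sa'(1) l(1) w] cmp_assoc[OF sa'(1) w' s] cmp_assoc[OF s sa(1) w]
      by (simp add: l(2) sa(2) sa'(2) cmp_idt_left[OF s] cmp_idt_right[OF s])
    show "act (Tm N) (cmp \<C> (lift N \<sigma> A) (sect N \<Delta> (act (Ty N) \<sigma> A) (act (Tm N) \<sigma> a))) (var N \<Gamma> A)
        = act (Tm N) (cmp \<C> (sect N \<Gamma> A a) \<sigma>) (var N \<Gamma> A)"
      by (simp add: Tm.act_cmp[OF sa'(1) l(1) v] Tm.act_cmp[OF s sa(1) v] l(3) sa(3) sa'(3))
  qed
qed

text \<open>After \<open>wk\<close>, the inner weakening cancels against the section and
  \<open>wk\<close> remains; the variable is sent to itself. The equation undoes the weakening that
  the eta rule performs on \<open>B\<close> and on bodies.\<close>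

lemma lift_wk_sect_var:
  assumes \<Gamma>: "\<Gamma> \<in> Obj \<C>" and A: "A \<in> el (Ty N) \<Gamma>"
  shows "cmp \<C> (lift N (wk N \<Gamma> A) A)
      (sect N (ext N \<Gamma> A) (act (Ty N) (wk N \<Gamma> A) A) (var N \<Gamma> A)) = idt \<C> (ext N \<Gamma> A)"
proof -
  note w = wk_hom[OF \<Gamma> A] and e = ext_obj[OF \<Gamma> A]
  have A': "act (Ty N) (wk N \<Gamma> A) A \<in> el (Ty N) (ext N \<Gamma> A)" using w A by (simp add: Ty.act_el)
  note l = lift_props[OF w A]
  note s = sect_props[OF e A' var_tms[OF \<Gamma> A]]
  note w' = wk_hom[OF e A'] and v = var_el[OF \<Gamma> A]
  show ?thesis
  proof (rule ext_hom_eqI[OF A \<Gamma> cmp_hom[OF s(1) l(1)] idt_hom[OF e]])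
    show "cmp \<C> (wk N \<Gamma> A) (cmp \<C> (lift N (wk N \<Gamma> A) A)
        (sect N (ext N \<Gamma> A) (act (Ty N) (wk N \<Gamma> A) A) (var N \<Gamma> A)))
        = cmp \<C> (wk N \<Gamma> A) (idt \<C> (ext N \<Gamma> A))"
      using cmp_assoc[OF s(1) l(1) w] cmp_assoc[OF s(1) w' w] by (simp add: l(2) s(2))
    show "act (Tm N) (cmp \<C> (lift N (wk N \<Gamma> A) A)
        (sect N (ext N \<Gamma> A) (act (Ty N) (wk N \<Gamma> A) A) (var N \<Gamma> A))) (var N \<Gamma> A)
        = act (Tm N) (idt \<C> (ext N \<Gamma> A)) (var N \<Gamma> A)"
      by (simp add: Tm.act_cmp[OF s(1) l(1) v] Tm.act_idt[OF e v] l(3) s(3))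
  qed
qed

section \<open>The presheaf of types with data over their extension\<close>

lemma presheaf_sum_psh:
  assumes "presheaf \<C> X"
  shows "presheaf \<C> (sum_psh N X)"
proof -
  interpret X: presheaf "Cx N" X by fact
  show ?thesis
    \<comment> \<open>In the second component the identity and composition laws reduce to
      \<open>lift_idt\<close> and \<open>lift_cmp\<close>.\<close>
    apply unfold_locales
    subgoal by (auto simp: sum_psh_def Ty.act_el intro: X.act_el[OF lift_props(1)])
    subgoal by (auto simp: sum_psh_def Ty.act_idt lift_idt ext_obj X.act_idt)
    subgoal for \<tau> \<Theta> \<Delta> \<sigma> \<Gamma> x
      by (auto simp: sum_psh_def Ty.act_cmp lift_cmp Ty.act_el
          intro!: X.act_cmp[OF lift_props(1) lift_props(1)])
    done
qed

lemma el_sum_psh: "el (sum_psh N X) \<Gamma> = (SIGMA A : el (Ty N) \<Gamma>. el X (ext N \<Gamma> A))"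
  by (simp add: sum_psh_def)

lemma act_sum_psh: "act (sum_psh N X) \<sigma> (A, x) = (act (Ty N) \<sigma> A, act X (lift N \<sigma> A) x)"
  by (simp add: sum_psh_def)

text \<open>Naturality along \<sigma> is naturality of \<theta> along the lifted substitution
  \<open>lift N \<sigma> A\<close>.\<close>

lemma sum_map_nat:
  assumes "nat_trans \<C> X Y \<theta>"
  shows "nat_trans \<C> (sum_psh N X) (sum_psh N Y) (sum_map N X \<theta>)"
  unfolding sum_map_def
  by (intro nat_transI presheaf_sum_psh nat_trans_presheaf[OF assms])
     (auto simp: el_sum_psh act_sum_psh nat_trans_act[OF assms] lift_props(1)
       nat_trans_act[OF assms lift_props(1)] intro: nat_trans_el[OF assms] ext_obj)

lemma sum_map_apply:
  "\<Gamma> \<in> Obj \<C> \<Longrightarrow> A \<in> el (Ty N) \<Gamma> \<Longrightarrow> x \<in> el X (ext N \<Gamma> A) \<Longrightarrow>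
   sum_map N X \<theta> \<Gamma> (A, x) = (A, \<theta> (ext N \<Gamma> A) x)"
  by (simp add: sum_map_def el_sum_psh)

end

section \<open>From product operations to the pullback square\<close>

context pi_model
begin

section \<open>Typing of the operations and bijectivity of abstraction\<close>

lemma pi_el:
  "\<Gamma> \<in> Obj \<C> \<Longrightarrow> A \<in> el (Ty N) \<Gamma> \<Longrightarrow> B \<in> el (Ty N) (ext N \<Gamma> A) \<Longrightarrow> pi \<Gamma> A B \<in> el (Ty N) \<Gamma>"
  by (rule PiE_mem[OF PiE_mem[OF PiE_mem[OF pi_type]]])

lemma lam_tms:
  "\<Gamma> \<in> Obj \<C> \<Longrightarrow> A \<in> el (Ty N) \<Gamma> \<Longrightarrow> B \<in> el (Ty N) (ext N \<Gamma> A) \<Longrightarrow> b \<in> tms N (ext N \<Gamma> A) B \<Longrightarrow>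
   lam \<Gamma> A B b \<in> tms N \<Gamma> (pi \<Gamma> A B)"
  by (rule PiE_mem[OF PiE_mem[OF PiE_mem[OF PiE_mem[OF lam_type]]]])

lemma app_tms:
  "\<Gamma> \<in> Obj \<C> \<Longrightarrow> A \<in> el (Ty N) \<Gamma> \<Longrightarrow> B \<in> el (Ty N) (ext N \<Gamma> A) \<Longrightarrow> f \<in> tms N \<Gamma> (pi \<Gamma> A B) \<Longrightarrow>
   a \<in> tms N \<Gamma> A \<Longrightarrow> app \<Gamma> A B f a \<in> tms N \<Gamma> (act (Ty N) (sect N \<Gamma> A a) B)"
  by (rule PiE_mem[OF PiE_mem[OF PiE_mem[OF PiE_mem[OF PiE_mem[OF app_type]]]]])

text \<open>This is the argument of \<open>lam\<close> in the eta rule, named as the candidate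
  inverse of abstraction.\<close>

definition unlam :: "'o \<Rightarrow> 'ty \<Rightarrow> 'ty \<Rightarrow> 'tm \<Rightarrow> 'tm" where
  "unlam \<Gamma> A B f = app (ext N \<Gamma> A) (act (Ty N) (wk N \<Gamma> A) A) (act (Ty N) (lift N (wk N \<Gamma> A) A) B)
     (act (Tm N) (wk N \<Gamma> A) f) (var N \<Gamma> A)"

lemma
  assumes \<Gamma>: "\<Gamma> \<in> Obj \<C>" and A: "A \<in> el (Ty N) \<Gamma>" and B: "B \<in> el (Ty N) (ext N \<Gamma> A)"
  shows unlam_tms: "f \<in> tms N \<Gamma> (pi \<Gamma> A B) \<Longrightarrow> unlam \<Gamma> A B f \<in> tms N (ext N \<Gamma> A) B"
    and unlam_lam: "b \<in> tms N (ext N \<Gamma> A) B \<Longrightarrow> unlam \<Gamma> A B (lam \<Gamma> A B b) = b"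
    and lam_unlam: "f \<in> tms N \<Gamma> (pi \<Gamma> A B) \<Longrightarrow> lam \<Gamma> A B (unlam \<Gamma> A B f) = f"
proof -
  note w = wk_hom[OF \<Gamma> A] and e = ext_obj[OF \<Gamma> A] and v = var_tms[OF \<Gamma> A]
  note l = lift_props[OF w A]
  have A': "act (Ty N) (wk N \<Gamma> A) A \<in> el (Ty N) (ext N \<Gamma> A)" using w A by (simp add: Ty.act_el)
  note B' = Ty.act_el[OF l(1) B]
  note s = sect_props[OF e A' v]
  {
    assume f: "f \<in> tms N \<Gamma> (pi \<Gamma> A B)"
    show "unlam \<Gamma> A B f \<in> tms N (ext N \<Gamma> A) B"
      \<comment> \<open>The application has as type \<open>B\<close> substituted along the lifted
        weakening and then along the section of the variable; the composite is the identity.\<close>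
      using app_tms[OF e A' B' tms_act[OF w f, unfolded pi_subst[OF e \<Gamma> w A B]] v]
      by (simp add: unlam_def Ty.act_cmp[OF s(1) l(1) B, symmetric] lift_wk_sect_var[OF \<Gamma> A]
          Ty.act_idt[OF e B])
    show "lam \<Gamma> A B (unlam \<Gamma> A B f) = f"
      using eta[OF \<Gamma> A B f] by (simp add: unlam_def)
  next
    assume b: "b \<in> tms N (ext N \<Gamma> A) B"
    show "unlam \<Gamma> A B (lam \<Gamma> A B b) = b"
      \<comment> \<open>Weakening passes under \<open>lam\<close> by \<open>lam_subst\<close>; beta
        then leaves \<open>b\<close> under the same two substitutions, which cancel.\<close>
      using beta[OF e A' B' tms_act[OF l(1) b] v]
      by (simp add: unlam_def lam_subst[OF e \<Gamma> w A B b] lift_wk_sect_var[OF \<Gamma> A]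
          Tm.act_cmp[OF s(1) l(1) tms_el[OF b], symmetric] Tm.act_idt[OF e tms_el[OF b]])
  }
qed

lemma lam_ex1:
  assumes "\<Gamma> \<in> Obj \<C>" "A \<in> el (Ty N) \<Gamma>" "B \<in> el (Ty N) (ext N \<Gamma> A)" "f \<in> tms N \<Gamma> (pi \<Gamma> A B)"
  shows "\<exists>!b. b \<in> tms N (ext N \<Gamma> A) B \<and> lam \<Gamma> A B b = f"
  by (rule ex1I[of _ "unlam \<Gamma> A B f"]) (use assms in \<open>auto simp: unlam_tms unlam_lam lam_unlam\<close>)

text \<open>Writing \<open>f\<close> as an abstraction reduces the claim to beta. Hence
  \<open>app\<close> is determined by \<open>pi\<close> and \<open>lam\<close>, as injectivity of
  the correspondence requires.\<close>

lemma app_eq: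
  assumes "\<Gamma> \<in> Obj \<C>" "A \<in> el (Ty N) \<Gamma>" "B \<in> el (Ty N) (ext N \<Gamma> A)" "f \<in> tms N \<Gamma> (pi \<Gamma> A B)"
    and "a \<in> tms N \<Gamma> A"
  shows "app \<Gamma> A B f a =
    act (Tm N) (sect N \<Gamma> A a) (THE b. b \<in> tms N (ext N \<Gamma> A) B \<and> lam \<Gamma> A B b = f)"
  using beta[OF assms(1-3) _ assms(5)] theI'[OF lam_ex1[OF assms(1-4)]] by metis

section \<open>The natural transformations and the square of a model\<close>

lemma Pi_hat_apply:
  "\<Gamma> \<in> Obj \<C> \<Longrightarrow> A \<in> el (Ty N) \<Gamma> \<Longrightarrow> B \<in> el (Ty N) (ext N \<Gamma> A) \<Longrightarrow> Pi_hat N pi \<Gamma> (A, B) = pi \<Gamma> A B"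
  by (simp add: Pi_hat_def el_sum_psh)

lemma lam_hat_apply:
  assumes "\<Gamma> \<in> Obj \<C>" "A \<in> el (Ty N) \<Gamma>" "b \<in> tms N (ext N \<Gamma> A) B"
  shows "lam_hat N lam \<Gamma> (A, b) = lam \<Gamma> A B b"
  using assms by (simp add: lam_hat_def el_sum_psh tms_def)

lemma Pi_hat_nat: "nat_trans \<C> (sum_psh N (Ty N)) (Ty N) (Pi_hat N pi)"
  unfolding Pi_hat_def
  by (intro nat_transI presheaf_sum_psh Ty.presheaf_axioms)
     (auto simp: el_sum_psh act_sum_psh pi_el dest: hom_obj intro!: pi_subst[symmetric])

lemma lam_hat_nat: "nat_trans \<C> (sum_psh N (Tm N)) (Tm N) (lam_hat N lam)"
  unfolding lam_hat_def
proof (intro nat_transI presheaf_sum_psh Tm.presheaf_axioms)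
  fix \<Gamma> x
  assume "\<Gamma> \<in> Obj \<C>" "x \<in> el (sum_psh N (Tm N)) \<Gamma>"
  then show "(case x of (A, b) \<Rightarrow> lam \<Gamma> A (tp N (ext N \<Gamma> A) b) b) \<in> el (Tm N) \<Gamma>"
    using tm_ext_typing by (auto simp: el_sum_psh intro: tms_el[OF lam_tms])
next
  fix \<sigma> \<Delta> \<Gamma> x
  assume s: "\<sigma> \<in> hom \<C> \<Delta> \<Gamma>" and x: "x \<in> el (sum_psh N (Tm N)) \<Gamma>"
  obtain A b where [simp]: "x = (A, b)" and A: "A \<in> el (Ty N) \<Gamma>" and b: "b \<in> el (Tm N) (ext N \<Gamma> A)"
    using x by (auto simp: el_sum_psh)
  note o = hom_obj[OF s]
  \<comment> \<open>The type of the substituted body is the substituted type, by naturality of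
    \<open>tp\<close>, so the type argument of \<open>lam\<close> matches that in
    \<open>lam_subst\<close>.\<close>
  show "(case act (sum_psh N (Tm N)) \<sigma> x of (A, b) \<Rightarrow> lam \<Delta> A (tp N (ext N \<Delta> A) b) b)
      = act (Tm N) \<sigma> (case x of (A, b) \<Rightarrow> lam \<Gamma> A (tp N (ext N \<Gamma> A) b) b)"
    using tm_ext_typing[OF o(2) A b]
    by (simp add: act_sum_psh lam_subst[OF o s A] nat_trans_act[OF tp_nat lift_props(1)[OF s A] b])
qed

text \<open>Pointwise, commutativity is the typing rule of \<open>lam\<close>, and the unique lift
  of a compatible pair comes from \<open>lam_ex1\<close>. The pointwise criterion gives the
  universal property for cones in any universe \<open>\<V>\<close>.\<close>

lemma Pi_pullback:
  "is_pullback \<V> \<C> (sum_psh N (Tm N)) (Tm N) (sum_psh N (Ty N)) (Ty N)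
     (lam_hat N lam) (sum_map N (Tm N) (tp N)) (tp N) (Pi_hat N pi)"
proof (rule is_pullbackI[OF lam_hat_nat sum_map_nat[OF tp_nat] tp_nat Pi_hat_nat])
  fix \<Gamma> x
  assume \<Gamma>: "\<Gamma> \<in> Obj \<C>" and x: "x \<in> el (sum_psh N (Tm N)) \<Gamma>"
  obtain A b where [simp]: "x = (A, b)" and A: "A \<in> el (Ty N) \<Gamma>" and b: "b \<in> el (Tm N) (ext N \<Gamma> A)"
    using x by (auto simp: el_sum_psh)
  note t = tm_ext_typing[OF \<Gamma> A b]
  show "tp N \<Gamma> (lam_hat N lam \<Gamma> x) = Pi_hat N pi \<Gamma> (sum_map N (Tm N) (tp N) \<Gamma> x)"
    using tms_tp[OF lam_tms[OF \<Gamma> A conjunct1[OF t] conjunct2[OF t]]] t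
    by (simp add: lam_hat_apply[OF \<Gamma> A conjunct2[OF t]] sum_map_apply[where X = "Tm N", OF \<Gamma> A b]
        Pi_hat_apply[OF \<Gamma> A])
next
  fix \<Gamma> f y
  assume \<Gamma>: "\<Gamma> \<in> Obj \<C>" and f: "f \<in> el (Tm N) \<Gamma>" and y: "y \<in> el (sum_psh N (Ty N)) \<Gamma>"
    and fy: "tp N \<Gamma> f = Pi_hat N pi \<Gamma> y"
  obtain A B where [simp]: "y = (A, B)" and A: "A \<in> el (Ty N) \<Gamma>" and B: "B \<in> el (Ty N) (ext N \<Gamma> A)"
    using y by (auto simp: el_sum_psh)
  \<comment> \<open>Compatibility of \<open>f\<close> with the pair \<open>(A, B)\<close> says
    exactly that \<open>f\<close> is a term of the product type.\<close>
  have "f \<in> tms N \<Gamma> (pi \<Gamma> A B)" using f fy by (simp add: tms_def Pi_hat_apply[OF \<Gamma> A B])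
  then obtain b where b: "b \<in> tms N (ext N \<Gamma> A) B" "lam \<Gamma> A B b = f"
    and uniq: "\<And>b'. b' \<in> tms N (ext N \<Gamma> A) B \<Longrightarrow> lam \<Gamma> A B b' = f \<Longrightarrow> b' = b"
    using lam_ex1[OF \<Gamma> A B] by blast
  show "\<exists>!x. x \<in> el (sum_psh N (Tm N)) \<Gamma> \<and> lam_hat N lam \<Gamma> x = f \<and> sum_map N (Tm N) (tp N) \<Gamma> x = y"
  proof (rule ex1I[of _ "(A, b)"])
    show "(A, b) \<in> el (sum_psh N (Tm N)) \<Gamma> \<and> lam_hat N lam \<Gamma> (A, b) = f \<and>
        sum_map N (Tm N) (tp N) \<Gamma> (A, b) = y"
      using A b(2) tms_el[OF b(1)] tms_tp[OF b(1)]
      by (simp add: el_sum_psh lam_hat_apply[OF \<Gamma> A b(1)] sum_map_apply[where X = "Tm N", OF \<Gamma> A])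
  next
    fix x
    assume x: "x \<in> el (sum_psh N (Tm N)) \<Gamma> \<and> lam_hat N lam \<Gamma> x = f \<and> sum_map N (Tm N) (tp N) \<Gamma> x = y"
    \<comment> \<open>The value of \<open>sum_map\<close> fixes the first component as
      \<open>A\<close> and the type of the second as \<open>B\<close>.\<close>
    then obtain b' where x': "x = (A, b')" "b' \<in> tms N (ext N \<Gamma> A) B"
      by (auto simp: el_sum_psh sum_map_apply[where X = "Tm N", OF \<Gamma>] tms_def)
    with x show "x = (A, b)" by (simp add: uniq lam_hat_apply[OF \<Gamma> A x'(2)])
  qed
qed

end

text \<open>\<open>Pi_hat\<close> shows all values of \<open>pi\<close> on its domain.
  \<open>lam_hat\<close> does so for \<open>lam\<close>, since \<open>B\<close> is the type of
  \<open>b\<close>. Finally \<open>app\<close> is computed from these two, and outside the domains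
  all operations are \<open>undefined\<close>.\<close>

lemma pi_model_eqI:
  assumes "pi_model \<U> N pi lam app" "pi_model \<U> N pi' lam' app'"
    and P: "Pi_hat N pi = Pi_hat N pi'" and L: "lam_hat N lam = lam_hat N lam'"
  shows "pi = pi' \<and> lam = lam' \<and> app = app'"
proof -
  interpret M: pi_model \<U> N pi lam app by fact
  interpret M': pi_model \<U> N pi' lam' app' by fact
  have pi: "pi = pi'"
    by (intro PiE_ext[OF M.pi_type M'.pi_type] PiE_ext[OF PiE_mem[OF M.pi_type] PiE_mem[OF M'.pi_type]]
        PiE_ext[OF PiE_mem[OF PiE_mem[OF M.pi_type]] PiE_mem[OF PiE_mem[OF M'.pi_type]]])
       (metis M.Pi_hat_apply M'.Pi_hat_apply P)+
  \<comment> \<open>Rewriting with the equality of the \<open>pi\<close> operations gives both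
    abstractions the same dependent function space, so that they can be compared argument by
    argument.\<close>
  note lt = M.lam_type and lt' = M'.lam_type[folded pi]
  have lam: "lam = lam'"
    by (intro PiE_ext[OF lt lt'] PiE_ext[OF PiE_mem[OF lt] PiE_mem[OF lt']]
        PiE_ext[OF PiE_mem[OF PiE_mem[OF lt]] PiE_mem[OF PiE_mem[OF lt']]]
        PiE_ext[OF PiE_mem[OF PiE_mem[OF PiE_mem[OF lt]]] PiE_mem[OF PiE_mem[OF PiE_mem[OF lt']]]])
       (metis M.lam_hat_apply M'.lam_hat_apply L)+
  note at = M.app_type and at' = M'.app_type[folded pi]
  have "app = app'"
    by (intro PiE_ext[OF at at'] PiE_ext[OF PiE_mem[OF at] PiE_mem[OF at']]
        PiE_ext[OF PiE_mem[OF PiE_mem[OF at]] PiE_mem[OF PiE_mem[OF at']]]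
        PiE_ext[OF PiE_mem[OF PiE_mem[OF PiE_mem[OF at]]] PiE_mem[OF PiE_mem[OF PiE_mem[OF at']]]]
        PiE_ext[OF PiE_mem[OF PiE_mem[OF PiE_mem[OF PiE_mem[OF at]]]]
          PiE_mem[OF PiE_mem[OF PiE_mem[OF PiE_mem[OF at']]]]])
       (simp_all add: M.app_eq M'.app_eq[folded pi lam])
  with pi lam show ?thesis by simp
qed

section \<open>From the pullback square to product operations\<close>

locale pi_square = natural_model \<U> N
  for \<U> :: "'x itself" and N :: "('o, 'm, 'ty, 'tm) nat_model" +
  fixes P :: "'o \<Rightarrow> 'ty \<times> 'ty \<Rightarrow> 'ty" and L :: "'o \<Rightarrow> 'ty \<times> 'tm \<Rightarrow> 'tm"
  assumes P_nat: "nat_trans (Cx N) (sum_psh N (Ty N)) (Ty N) P"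
    and L_nat: "nat_trans (Cx N) (sum_psh N (Tm N)) (Tm N) L"
    and square_pullback: "is_pullback \<U> (Cx N) (sum_psh N (Tm N)) (Tm N) (sum_psh N (Ty N)) (Ty N)
      L (sum_map N (Tm N) (tp N)) (tp N) P"
begin

section \<open>Reading typing, substitution and inverses off the square\<close>

lemma P_el:
  "\<Gamma> \<in> Obj \<C> \<Longrightarrow> A \<in> el (Ty N) \<Gamma> \<Longrightarrow> B \<in> el (Ty N) (ext N \<Gamma> A) \<Longrightarrow> P \<Gamma> (A, B) \<in> el (Ty N) \<Gamma>"
  by (rule nat_trans_el[OF P_nat]) (simp_all add: el_sum_psh)

text \<open>Commutativity of the square at \<open>(A, b)\<close> is the typing rule for
  abstraction.\<close>

lemma L_tms:
  assumes \<Gamma>: "\<Gamma> \<in> Obj \<C>" and A: "A \<in> el (Ty N) \<Gamma>" and b: "b \<in> tms N (ext N \<Gamma> A) B"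
  shows "L \<Gamma> (A, b) \<in> tms N \<Gamma> (P \<Gamma> (A, B))"
proof -
  have "(A, b) \<in> el (sum_psh N (Tm N)) \<Gamma>" using A b by (simp add: el_sum_psh tms_def)
  from nat_trans_el[OF L_nat \<Gamma> this] is_pullback_square[OF square_pullback \<Gamma> this]
  show ?thesis
    using tms_tp[OF b] by (simp add: tms_def sum_map_apply[where X = "Tm N", OF \<Gamma> A tms_el[OF b]])
qed

lemma P_subst:
  "\<sigma> \<in> hom \<C> \<Delta> \<Gamma> \<Longrightarrow> A \<in> el (Ty N) \<Gamma> \<Longrightarrow> B \<in> el (Ty N) (ext N \<Gamma> A) \<Longrightarrow>
   act (Ty N) \<sigma> (P \<Gamma> (A, B)) = P \<Delta> (act (Ty N) \<sigma> A, act (Ty N) (lift N \<sigma> A) B)"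
  using nat_trans_act[OF P_nat, of \<sigma> \<Delta> \<Gamma> "(A, B)"] by (simp add: el_sum_psh act_sum_psh)

lemma L_subst:
  "\<sigma> \<in> hom \<C> \<Delta> \<Gamma> \<Longrightarrow> A \<in> el (Ty N) \<Gamma> \<Longrightarrow> b \<in> el (Tm N) (ext N \<Gamma> A) \<Longrightarrow>
   act (Tm N) \<sigma> (L \<Gamma> (A, b)) = L \<Delta> (act (Ty N) \<sigma> A, act (Tm N) (lift N \<sigma> A) b)"
  using nat_trans_act[OF L_nat, of \<sigma> \<Delta> \<Gamma> "(A, b)"] by (simp add: el_sum_psh act_sum_psh)

text \<open>The inverse of abstraction at fixed \<open>A\<close> and \<open>B\<close>; the
  description is proper for \<open>f\<close> of type \<open>P \<Gamma> (A, B)\<close> by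
  \<open>L_ex1\<close>.\<close>

definition body :: "'o \<Rightarrow> 'ty \<Rightarrow> 'ty \<Rightarrow> 'tm \<Rightarrow> 'tm" where
  "body \<Gamma> A B f = (THE b. b \<in> tms N (ext N \<Gamma> A) B \<and> L \<Gamma> (A, b) = f)"

text \<open>The square is a pullback at \<Gamma>, and \<open>f\<close> and \<open>(A, B)\<close>
  form a compatible pair there.\<close>

lemma L_ex1:
  assumes \<Gamma>: "\<Gamma> \<in> Obj \<C>" and A: "A \<in> el (Ty N) \<Gamma>" and B: "B \<in> el (Ty N) (ext N \<Gamma> A)"
    and f: "f \<in> tms N \<Gamma> (P \<Gamma> (A, B))"
  shows "\<exists>!b. b \<in> tms N (ext N \<Gamma> A) B \<and> L \<Gamma> (A, b) = f"
proof -
  have "\<exists>!p. p \<in> el (sum_psh N (Tm N)) \<Gamma> \<and> L \<Gamma> p = f \<and> sum_map N (Tm N) (tp N) \<Gamma> p = (A, B)"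
    by (rule is_pullback_pointwise[OF square_pullback small \<Gamma>])
       (use A B f in \<open>auto simp: el_sum_psh tms_def\<close>)
  \<comment> \<open>A point over \<open>(A, B)\<close> has first component \<open>A\<close>, so
    uniqueness of pairs becomes uniqueness of their second components.\<close>
  moreover have "(A', b) \<in> el (sum_psh N (Tm N)) \<Gamma> \<and> L \<Gamma> (A', b) = f \<and>
      sum_map N (Tm N) (tp N) \<Gamma> (A', b) = (A, B) \<longleftrightarrow>
      A' = A \<and> b \<in> tms N (ext N \<Gamma> A) B \<and> L \<Gamma> (A, b) = f" for A' b
    using A by (auto simp: el_sum_psh tms_def sum_map_apply[where X = "Tm N", OF \<Gamma>])
  ultimately show ?thesis by (auto simp: Ex1_def split_paired_Ex split_paired_All)
qed

lemma
  assumes "\<Gamma> \<in> Obj \<C>" "A \<in> el (Ty N) \<Gamma>" "B \<in> el (Ty N) (ext N \<Gamma> A)" "f \<in> tms N \<Gamma> (P \<Gamma> (A, B))"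
  shows body_tms: "body \<Gamma> A B f \<in> tms N (ext N \<Gamma> A) B"
    and L_body: "L \<Gamma> (A, body \<Gamma> A B f) = f"
  using theI'[OF L_ex1[OF assms]] by (simp_all add: body_def)

lemma body_L:
  assumes "\<Gamma> \<in> Obj \<C>" "A \<in> el (Ty N) \<Gamma>" "B \<in> el (Ty N) (ext N \<Gamma> A)" "b \<in> tms N (ext N \<Gamma> A) B"
  shows "body \<Gamma> A B (L \<Gamma> (A, b)) = b"
  unfolding body_def using L_ex1[OF assms(1-3) L_tms[OF assms(1,2,4)]] assms(4)
  by (intro the1_equality) auto

text \<open>By naturality of \<open>L\<close>, the substituted body abstracts to the substituted
  \<open>f\<close>, and \<open>body\<close> recovers the term that was abstracted.\<close>

lemma body_subst:
  assumes s: "\<sigma> \<in> hom \<C> \<Delta> \<Gamma>" and A: "A \<in> el (Ty N) \<Gamma>" and B: "B \<in> el (Ty N) (ext N \<Gamma> A)"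
    and f: "f \<in> tms N \<Gamma> (P \<Gamma> (A, B))"
  shows "body \<Delta> (act (Ty N) \<sigma> A) (act (Ty N) (lift N \<sigma> A) B) (act (Tm N) \<sigma> f)
    = act (Tm N) (lift N \<sigma> A) (body \<Gamma> A B f)"
proof -
  note o = hom_obj[OF s] and l = lift_props(1)[OF s A]
  note b = body_tms[OF o(2) A B f]
  have "act (Tm N) \<sigma> f = L \<Delta> (act (Ty N) \<sigma> A, act (Tm N) (lift N \<sigma> A) (body \<Gamma> A B f))"
    using L_subst[OF s A tms_el[OF b]] by (simp add: L_body[OF o(2) A B f])
  then show ?thesis
    using body_L[OF o(1) Ty.act_el[OF s A] Ty.act_el[OF l B] tms_act[OF l b]] by simp
qed

section \<open>Product operations built from the square\<close>

definition pi_op :: "'o \<Rightarrow> 'ty \<Rightarrow> 'ty \<Rightarrow> 'ty" where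
  "pi_op = (\<lambda>\<Gamma> \<in> Obj \<C>. \<lambda>A \<in> el (Ty N) \<Gamma>. \<lambda>B \<in> el (Ty N) (ext N \<Gamma> A). P \<Gamma> (A, B))"

definition lam_op :: "'o \<Rightarrow> 'ty \<Rightarrow> 'ty \<Rightarrow> 'tm \<Rightarrow> 'tm" where
  "lam_op = (\<lambda>\<Gamma> \<in> Obj \<C>. \<lambda>A \<in> el (Ty N) \<Gamma>. \<lambda>B \<in> el (Ty N) (ext N \<Gamma> A).
     \<lambda>b \<in> tms N (ext N \<Gamma> A) B. L \<Gamma> (A, b))"

text \<open>The value is the one that beta forces once \<open>f\<close> is written as the
  abstraction of its body.\<close>

definition app_op :: "'o \<Rightarrow> 'ty \<Rightarrow> 'ty \<Rightarrow> 'tm \<Rightarrow> 'tm \<Rightarrow> 'tm" where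
  "app_op = (\<lambda>\<Gamma> \<in> Obj \<C>. \<lambda>A \<in> el (Ty N) \<Gamma>. \<lambda>B \<in> el (Ty N) (ext N \<Gamma> A).
     \<lambda>f \<in> tms N \<Gamma> (P \<Gamma> (A, B)). \<lambda>a \<in> tms N \<Gamma> A. act (Tm N) (sect N \<Gamma> A a) (body \<Gamma> A B f))"

lemma pi_op_apply [simp]:
  "\<Gamma> \<in> Obj \<C> \<Longrightarrow> A \<in> el (Ty N) \<Gamma> \<Longrightarrow> B \<in> el (Ty N) (ext N \<Gamma> A) \<Longrightarrow> pi_op \<Gamma> A B = P \<Gamma> (A, B)"
  by (simp add: pi_op_def)

lemma lam_op_apply [simp]:
  "\<Gamma> \<in> Obj \<C> \<Longrightarrow> A \<in> el (Ty N) \<Gamma> \<Longrightarrow> B \<in> el (Ty N) (ext N \<Gamma> A) \<Longrightarrow> b \<in> tms N (ext N \<Gamma> A) B \<Longrightarrow>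
   lam_op \<Gamma> A B b = L \<Gamma> (A, b)"
  by (simp add: lam_op_def)

lemma app_op_apply [simp]:
  "\<Gamma> \<in> Obj \<C> \<Longrightarrow> A \<in> el (Ty N) \<Gamma> \<Longrightarrow> B \<in> el (Ty N) (ext N \<Gamma> A) \<Longrightarrow> f \<in> tms N \<Gamma> (P \<Gamma> (A, B)) \<Longrightarrow>
   a \<in> tms N \<Gamma> A \<Longrightarrow> app_op \<Gamma> A B f a = act (Tm N) (sect N \<Gamma> A a) (body \<Gamma> A B f)"
  by (simp add: app_op_def)

lemma pi_model_op: "pi_model \<U> N pi_op lam_op app_op"
proof
  show "pi_op \<in> (\<Pi>\<^sub>E \<Gamma> \<in> Obj \<C>. \<Pi>\<^sub>E A \<in> el (Ty N) \<Gamma>. el (Ty N) (ext N \<Gamma> A) \<rightarrow>\<^sub>E el (Ty N) \<Gamma>)"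
    by (auto simp: pi_op_def restrict_PiE_iff P_el)
next
  show "lam_op \<in> (\<Pi>\<^sub>E \<Gamma> \<in> Obj \<C>. \<Pi>\<^sub>E A \<in> el (Ty N) \<Gamma>. \<Pi>\<^sub>E B \<in> el (Ty N) (ext N \<Gamma> A).
      tms N (ext N \<Gamma> A) B \<rightarrow>\<^sub>E tms N \<Gamma> (pi_op \<Gamma> A B))"
    by (auto simp: lam_op_def restrict_PiE_iff L_tms)
next
  show "app_op \<in> (\<Pi>\<^sub>E \<Gamma> \<in> Obj \<C>. \<Pi>\<^sub>E A \<in> el (Ty N) \<Gamma>. \<Pi>\<^sub>E B \<in> el (Ty N) (ext N \<Gamma> A).
      \<Pi>\<^sub>E f \<in> tms N \<Gamma> (pi_op \<Gamma> A B). \<Pi>\<^sub>E a \<in> tms N \<Gamma> A. tms N \<Gamma> (act (Ty N) (sect N \<Gamma> A a) B))"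
    by (auto simp: app_op_def restrict_PiE_iff body_tms sect_props(1) tms_act[OF sect_props(1)])
next
  fix \<Delta> \<Gamma> \<sigma> A B
  assume o: "\<Delta> \<in> Obj \<C>" "\<Gamma> \<in> Obj \<C>" and s: "\<sigma> \<in> hom \<C> \<Delta> \<Gamma>"
    and A: "A \<in> el (Ty N) \<Gamma>" and B: "B \<in> el (Ty N) (ext N \<Gamma> A)"
  note l = lift_props(1)[OF s A]
  note A' = Ty.act_el[OF s A] and B' = Ty.act_el[OF l B]
  show "act (Ty N) \<sigma> (pi_op \<Gamma> A B) = pi_op \<Delta> (act (Ty N) \<sigma> A) (act (Ty N) (lift N \<sigma> A) B)"
    using o A B A' B' by (simp add: P_subst[OF s A B])
  {
    fix b
    assume b: "b \<in> tms N (ext N \<Gamma> A) B"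
    show "act (Tm N) \<sigma> (lam_op \<Gamma> A B b) =
        lam_op \<Delta> (act (Ty N) \<sigma> A) (act (Ty N) (lift N \<sigma> A) B) (act (Tm N) (lift N \<sigma> A) b)"
      using o A B A' B' b tms_act[OF l b] by (simp add: L_subst[OF s A tms_el[OF b]])
  next
    fix f a
    assume "f \<in> tms N \<Gamma> (pi_op \<Gamma> A B)" and a: "a \<in> tms N \<Gamma> A"
    then have f: "f \<in> tms N \<Gamma> (P \<Gamma> (A, B))" using o A B by simp
    note f' = tms_act[OF s f, unfolded P_subst[OF s A B]] and a' = tms_act[OF s a]
    note b = tms_el[OF body_tms[OF o(2) A B f]]
    note sa = sect_props(1)[OF o(2) A a] and sa' = sect_props(1)[OF o(1) A' a']
    \<comment> \<open>Each side acts on the body by a composite substitution, and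
      \<open>lift_sect\<close> equates the two composites.\<close>
    have "act (Tm N) (sect N \<Delta> (act (Ty N) \<sigma> A) (act (Tm N) \<sigma> a))
        (act (Tm N) (lift N \<sigma> A) (body \<Gamma> A B f))
        = act (Tm N) \<sigma> (act (Tm N) (sect N \<Gamma> A a) (body \<Gamma> A B f))"
      by (simp add: Tm.act_cmp[OF sa' l b, symmetric] Tm.act_cmp[OF s sa b, symmetric]
          lift_sect[OF s A a])
    then show "act (Tm N) \<sigma> (app_op \<Gamma> A B f a) =
        app_op \<Delta> (act (Ty N) \<sigma> A) (act (Ty N) (lift N \<sigma> A) B) (act (Tm N) \<sigma> f) (act (Tm N) \<sigma> a)"
      using o A B A' B' f a f' a' by (simp add: body_subst[OF s A B f])
  }
next
  fix \<Gamma> A B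
  assume \<Gamma>: "\<Gamma> \<in> Obj \<C>" and A: "A \<in> el (Ty N) \<Gamma>" and B: "B \<in> el (Ty N) (ext N \<Gamma> A)"
  {
    fix b a
    assume "b \<in> tms N (ext N \<Gamma> A) B" "a \<in> tms N \<Gamma> A"
    then show "app_op \<Gamma> A B (lam_op \<Gamma> A B b) a = act (Tm N) (sect N \<Gamma> A a) b"
      using \<Gamma> A B by (simp add: L_tms body_L)
  next
    fix f
    assume "f \<in> tms N \<Gamma> (pi_op \<Gamma> A B)"
    then have f: "f \<in> tms N \<Gamma> (P \<Gamma> (A, B))" using \<Gamma> A B by simp
    note w = wk_hom[OF \<Gamma> A] and e = ext_obj[OF \<Gamma> A] and v = var_tms[OF \<Gamma> A]
    note l = lift_props(1)[OF w A]
    note A' = Ty.act_el[OF w A] and B' = Ty.act_el[OF l B]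
    note s = sect_props(1)[OF e A' v]
    note f' = tms_act[OF w f, unfolded P_subst[OF w A B]]
    note b = body_tms[OF \<Gamma> A B f]
    \<comment> \<open>By \<open>body_subst\<close> the body of the weakened \<open>f\<close> is the
      weakened body; instantiating it at the variable cancels the weakening.\<close>
    have "app_op (ext N \<Gamma> A) (act (Ty N) (wk N \<Gamma> A) A) (act (Ty N) (lift N (wk N \<Gamma> A) A) B)
        (act (Tm N) (wk N \<Gamma> A) f) (var N \<Gamma> A) = body \<Gamma> A B f"
      using app_op_apply[OF e A' B' f' v] Tm.act_cmp[OF s l tms_el[OF b]]
      by (simp add: body_subst[OF w A B f] lift_wk_sect_var[OF \<Gamma> A] Tm.act_idt[OF e tms_el[OF b]])
    then show "lam_op \<Gamma> A B
        (app_op (ext N \<Gamma> A) (act (Ty N) (wk N \<Gamma> A) A) (act (Ty N) (lift N (wk N \<Gamma> A) A) B)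
          (act (Tm N) (wk N \<Gamma> A) f) (var N \<Gamma> A)) = f"
      using \<Gamma> A B b by (simp add: L_body[OF \<Gamma> A B f])
  }
qed

lemma Pi_hat_op: "Pi_hat N pi_op = P"
proof -
  interpret M: pi_model \<U> N pi_op lam_op app_op by (rule pi_model_op)
  show ?thesis
    by (rule nat_trans_eqI[OF M.Pi_hat_nat P_nat]) (auto simp: el_sum_psh M.Pi_hat_apply)
qed

text \<open>Each term over the extended context is read at its own type, where \<open>lam_op\<close>
  returns the value of \<open>L\<close>. With \<open>Pi_hat_op\<close> this yields
  surjectivity.\<close>

lemma lam_hat_op: "lam_hat N lam_op = L"
proof -
  interpret M: pi_model \<U> N pi_op lam_op app_op by (rule pi_model_op)
  show ?thesis
    by (rule nat_trans_eqI[OF M.lam_hat_nat L_nat])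
       (auto simp: el_sum_psh tm_ext_typing M.lam_hat_apply[OF _ _ conjunct2[OF tm_ext_typing]])
qed

end

section \<open>The correspondence as a bijection\<close>

theorem theorem2p2p13:
  "bij_betw
     (\<lambda>(N :: ('o, 'm, 'ty, 'tm) nat_model, pi, lam, app). (N, Pi_hat N pi, lam_hat N lam))
     {(N, pi, lam, app). pi_model TYPE('x) N pi lam app}
     {(N, P, L).
        natural_model TYPE('x) N \<and>
        nat_trans (Cx N) (sum_psh N (Ty N)) (Ty N) P \<and>
        nat_trans (Cx N) (sum_psh N (Tm N)) (Tm N) L \<and>
        is_pullback TYPE('x) (Cx N)
          (sum_psh N (Tm N)) (Tm N) (sum_psh N (Ty N)) (Ty N)
          L (sum_map N (Tm N) (tp N)) (tp N) P}"
  (is "bij_betw ?F ?M ?S")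
proof (rule bij_betw_imageI)
  show "inj_on ?F ?M"
    \<comment> \<open>The natural model is returned unchanged, so equal images are product
      structures on the same \<open>N\<close>.\<close>
    by (rule inj_onI, clarsimp) (metis pi_model_eqI)
  show "?F ` ?M = ?S"
  proof (intro equalityI subsetI)
    fix s
    assume "s \<in> ?F ` ?M"
    then obtain N pi lam app
      where m: "pi_model TYPE('x) N pi lam app" and s: "s = (N, Pi_hat N pi, lam_hat N lam)"
      by auto
    interpret pi_model "TYPE('x)" N pi lam app by fact
    show "s \<in> ?S"
      using natural_model_axioms Pi_hat_nat lam_hat_nat Pi_pullback by (simp add: s)
  next
    fix s
    assume "s \<in> ?S"
    then obtain N P L where s: "s = (N, P, L)" and sq: "pi_square TYPE('x) N P L"
      by (auto simp: pi_square_def pi_square_axioms_def)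
    interpret pi_square "TYPE('x)" N P L by fact
    \<comment> \<open>The operations built from the square provide the preimage.\<close>
    have "s = ?F (N, pi_op, lam_op, app_op)" by (simp add: s Pi_hat_op lam_hat_op)
    moreover have "(N, pi_op, lam_op, app_op) \<in> ?M" using pi_model_op by simp
    ultimately show "s \<in> ?F ` ?M" by (rule image_eqI)
  qed
qed

end
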